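(* Let $\mathcal G$ be a planar metric graph with a cycle double cover $\mathfrak C=(\mathcal C_i)_{1\le i\le k}$ and associated dual graph $\mathsf G_d$. Then the $k$ lowest eigenvalues of the Laplacian with natural conditions on $\mathcal G$ satisfy $$\lambda_i(\mathcal G)\ \ge\ 2\pi^2\,\alpha_i(\mathsf G_d)\,\min_{1\le j\le k}\frac{1}{|\mathcal C_j|^2},\qquad i=1,\dots,k .$$
   Context: Metric graphs. A metric graph $\mathcal G$ is obtained from finitely many intervals $(0,\ell_1),\dots,(0,\ell_E)$, with $E<\infty$ and $0<\ell_j<\infty$, by identifying endpoints in a graph-like fashion: each interval is an edge and the identified endpoints are the vertices. It carries the Lebesgue measure (denoted $|\cdot|$) and the natural path metric, and $L^2(\mathcal G)=\bigoplus_j L^2(0,\ell_j)$. Throughout, $\mathcal G$ has no loops; parallel edges are allowed. $\mathcal G$ is planar if its underlying combinatorial graph can be drawn in $\mathbb R^2$ without edge crossings. Laplacian with natural conditions (standard Laplacian). The operator $\Delta:(f_1,\dots,f_E)\mapsto(-f_1'',\dots,-f_E'')$ on $L^2(\mathcal G)$ whose domain consists of those $f\in\bigoplus_j H^2(0,\ell_j)$ that are continuous across the vertices and satisfy the Kirchhoff condition (at each vertex the sum of all normal derivatives along the incident edges vanishes). Its eigenvalues, counted with multiplicity in increasing order, are $0=\lambda_1(\mathcal G)\le\lambda_2(\mathcal G)\le\dots$. Cycle double cover. A double cover of $\mathcal G$ is a finite family $(\mathcal U_i)_{1\le i\le k}$ of connected metric subgraphs of $\mathcal G$ such that almost every $x\in\mathcal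 G$ belongs to $\mathcal U_i$ for exactly two distinct indices $i$. A cycle double cover is a double cover all of whose elements $\mathcal C_i$ are cycles within $\mathcal G$; $|\mathcal C_i|$ is the length of the cycle. Dual graph. The vicinity graph of the double cover, denoted $\mathsf G_d$ and called the dual graph, is the simple unoriented weighted graph with vertex set $\{1,\dots,k\}$ and edge weights $\mu_{ij}:=|\mathcal C_i\cap\mathcal C_j|$ for $i\neq j$, $\mu_{ii}:=0$; $i\ne j$ are adjacent iff $\mu_{ij}>0$. (When the $\mathcal C_i$ are the cycles bounding the faces of a planar embedding of $\mathcal G$, this is the usual dual graph, with weight $\mu_{ij}$ equal to the total length of the boundary shared by faces $i$ and $j$.) Normalized Laplacian. For a simple weighted graph $G$ with edge weights $\mu_{vw}$ and weighted degrees $d_v=\sum_{w}\mu_{vw}$, the normalized Laplacian is $(\Lambda f)(v)=\frac1{d_v}\sum_{w}\mu_{vw}(f(v)-f(w))$; its eigenvalues in increasing order with multiplicity are $0=\alpha_1(G)\le\alpha_2(G)\le\dots$. *)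

theory Defs
  imports "HOL-Analysis.Analysis" "HOL-Library.Function_Algebras"
begin

section \<open>Metric graphs\<close>

text \<open>
  Edge \<open>e\<close> is the interval from \<open>0\<close> to \<open>len G e\<close>; its endpoint \<open>0\<close> is identified with the
  vertex \<open>tail G e\<close> and its endpoint \<open>len G e\<close> with \<open>head G e\<close>. The orientation only fixes the
  parametrisation. Every vertex is an endpoint of some edge, and the graph need not be connected.
\<close>

record ('v, 'e) mgraph =
  edges :: "'e set"
  tail :: "'e \<Rightarrow> 'v"
  head :: "'e \<Rightarrow> 'v"
  len :: "'e \<Rightarrow> real"

definition vertices :: "('v, 'e) mgraph \<Rightarrow> 'v set" where
  "vertices G = tail G ` edges G \<union> head G ` edges G"

locale metric_graph =
  fixes G :: "('v, 'e) mgraph"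
  assumes finite_edges: "finite (edges G)"
    and len_pos: "e \<in> edges G \<Longrightarrow> 0 < len G e"
    and no_loops: "e \<in> edges G \<Longrightarrow> tail G e \<noteq> head G e"

text \<open>
  Points are written \<open>(e, x)\<close> with \<open>x\<close> in the closed interval of \<open>e\<close>, before the endpoints are
  glued. Since the vertices form a null set, the measure and all almost-everywhere statements on
  the glued space can be read off on this disjoint union; continuity at the vertices is imposed
  separately below.
\<close>

definition edge_points :: "('v, 'e) mgraph \<Rightarrow> 'e set \<Rightarrow> ('e \<times> real) set" where
  "edge_points G F = (SIGMA e:F. {0..len G e})"

definition mg_measure :: "('v, 'e) mgraph \<Rightarrow> ('e \<times> real) measure" where
  "mg_measure G =
     restrict_space (count_space (edges G) \<Otimes>\<^sub>M lborel) (edge_points G (edges G))"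

definition mg_length :: "('v, 'e) mgraph \<Rightarrow> ('e \<times> real) set \<Rightarrow> real" where
  "mg_length G A = measure (mg_measure G) A"

text \<open>Drawing without crossings: distinct vertices go to distinct points, edges to simple arcs
  joining the images of their endpoints, and arcs meet only at images of common endpoints.\<close>

definition planar :: "('v, 'e) mgraph \<Rightarrow> bool" where
  "planar G \<longleftrightarrow>
     (\<exists>(p :: 'v \<Rightarrow> real^2) (\<gamma> :: 'e \<Rightarrow> real \<Rightarrow> real^2).
        inj_on p (vertices G) \<and>
        (\<forall>e\<in>edges G. arc (\<gamma> e) \<and> pathstart (\<gamma> e) = p (tail G e) \<and>
            pathfinish (\<gamma> e) = p (head G e)) \<and>
        (\<forall>e\<in>edges G. \<forall>v\<in>vertices G.
            p v \<in> path_image (\<gamma> e) \<longrightarrow> v \<in> {tail G e, head G e}) \<and>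
        (\<forall>e\<in>edges G. \<forall>e'\<in>edges G. e \<noteq> e' \<longrightarrow>
            path_image (\<gamma> e) \<inter> path_image (\<gamma> e') \<subseteq>
              p ` ({tail G e, head G e} \<inter> {tail G e', head G e'})))"


section \<open>Eigenvalues counted with multiplicity\<close>

text \<open>
  A (possibly unbounded) operator on a space of real functions is given by its graph \<open>T\<close>:
  \<open>T f u\<close> means that \<open>f\<close> belongs to the domain and is mapped to \<open>u\<close>.
\<close>

definition eigenspace :: "(('x \<Rightarrow> real) \<Rightarrow> ('x \<Rightarrow> real) \<Rightarrow> bool) \<Rightarrow> real \<Rightarrow> ('x \<Rightarrow> real) set" where
  "eigenspace T t = {f. T f (\<lambda>x. t * f x)}"

definition is_eigenvalue :: "(('x \<Rightarrow> real) \<Rightarrow> ('x \<Rightarrow> real) \<Rightarrow> bool) \<Rightarrow> real \<Rightarrow> bool" where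
  "is_eigenvalue T t \<longleftrightarrow> (\<exists>f\<in>eigenspace T t. f \<noteq> 0)"

definition multiplicity :: "(('x \<Rightarrow> real) \<Rightarrow> ('x \<Rightarrow> real) \<Rightarrow> bool) \<Rightarrow> real \<Rightarrow> nat" where
  "multiplicity T t = vector_space.dim (\<lambda>(c::real) f x. c * f x) (eigenspace T t)"

text \<open>
  The \<open>i\<close>-th eigenvalue (\<open>i \<ge> 1\<close>) in increasing order, for an operator whose eigenvalues are
  bounded below, without finite accumulation point and of finite multiplicity: the least \<open>t\<close>
  such that at least \<open>i\<close> eigenvalues, counted with multiplicity, are at most \<open>t\<close>. It is \<open>\<infinity>\<close> if
  there are fewer than \<open>i\<close> eigenvalues altogether.
\<close>

definition nth_eigenvalue :: "(('x \<Rightarrow> real) \<Rightarrow> ('x \<Rightarrow> real) \<Rightarrow> bool) \<Rightarrow> nat \<Rightarrow> ereal" where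
  "nth_eigenvalue T i =
     Inf (ereal ` {t. i \<le> (\<Sum>s\<in>{s. s \<le> t \<and> is_eigenvalue T s}. multiplicity T s)})"


section \<open>The Laplacian with natural conditions\<close>

definition L2_interval :: "real \<Rightarrow> (real \<Rightarrow> real) \<Rightarrow> bool" where
  "L2_interval l h \<longleftrightarrow>
     set_borel_measurable lborel {0..l} h \<and> set_integrable lborel {0..l} (\<lambda>x. (h x)\<^sup>2)"

text \<open>
  \<open>f\<close> is the continuous representative on \<open>[0, l]\<close> of an element of the Sobolev space
  \<open>H\<^sup>1(0, l)\<close> with weak derivative \<open>g\<close>, that is, \<open>f\<close> is the primitive of the
  square-integrable \<open>g\<close>.
\<close>

definition H1_deriv :: "real \<Rightarrow> (real \<Rightarrow> real) \<Rightarrow> (real \<Rightarrow> real) \<Rightarrow> bool" where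
  "H1_deriv l f g \<longleftrightarrow>
     L2_interval l g \<and> (\<forall>x\<in>{0..l}. f x = f 0 + (LINT t:{0..x}|lborel. g t))"

text \<open>
  \<open>g\<close> is the (unique) continuous representative of \<open>f'\<close> on the closed edges, so the endpoint
  values in the Kirchhoff condition make sense, and \<open>h\<close> is \<open>f''\<close>. The vertex function \<open>\<phi>\<close>
  expresses continuity across the vertices. Elements of the domain are represented by their
  continuous versions on the closed edges, extended by \<open>0\<close> outside, so that distinct functions
  represent distinct elements of \<open>L\<^sup>2\<close> and dimensions are counted correctly; the image \<open>u\<close> is only
  determined almost everywhere.
\<close>

definition laplacian ::
    "('v, 'e) mgraph \<Rightarrow> ('e \<times> real \<Rightarrow> real) \<Rightarrow> ('e \<times> real \<Rightarrow> real) \<Rightarrow> bool" where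
  "laplacian G f u \<longleftrightarrow>
     (\<forall>z. z \<notin> edge_points G (edges G) \<longrightarrow> f z = 0) \<and>
     (\<exists>(g :: 'e \<times> real \<Rightarrow> real) (h :: 'e \<times> real \<Rightarrow> real) (\<phi> :: 'v \<Rightarrow> real).
        (\<forall>e\<in>edges G. H1_deriv (len G e) (\<lambda>x. f (e, x)) (\<lambda>x. g (e, x)) \<and>
                     H1_deriv (len G e) (\<lambda>x. g (e, x)) (\<lambda>x. h (e, x))) \<and>
        (\<forall>e\<in>edges G. f (e, 0) = \<phi> (tail G e) \<and> f (e, len G e) = \<phi> (head G e)) \<and>
        (\<forall>v\<in>vertices G.
            (\<Sum>e | e \<in> edges G \<and> tail G e = v. g (e, 0)) +
            (\<Sum>e | e \<in> edges G \<and> head G e = v. - g (e, len G e)) = 0) \<and>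
        (AE z in mg_measure G. u z = - h z))"


section \<open>Cycle double covers and the dual graph\<close>

text \<open>Since parallel edges are allowed, a cycle may consist of two edges.\<close>

definition cycle_within :: "('v, 'e) mgraph \<Rightarrow> ('e \<times> real) set \<Rightarrow> bool" where
  "cycle_within G C \<longleftrightarrow>
     (\<exists>n \<ge> 2. \<exists>(vs :: nat \<Rightarrow> 'v) (es :: nat \<Rightarrow> 'e).
        inj_on vs {..<n} \<and> inj_on es {..<n} \<and> es ` {..<n} \<subseteq> edges G \<and>
        (\<forall>m<n. {tail G (es m), head G (es m)} = {vs m, vs (Suc m mod n)}) \<and>
        C = edge_points G (es ` {..<n}))"

text \<open>A family, not a set: the same cycle may occur with two different indices.\<close>

definition cycle_double_cover ::
    "('v, 'e) mgraph \<Rightarrow> nat \<Rightarrow> (nat \<Rightarrow> ('e \<times> real) set) \<Rightarrow> bool" where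
  "cycle_double_cover G k C \<longleftrightarrow>
     (\<forall>i\<in>{1..k}. cycle_within G (C i)) \<and>
     (AE z in mg_measure G. card {i \<in> {1..k}. z \<in> C i} = 2)"

text \<open>The dual graph has vertex set \<open>{1..k}\<close> and the following weights; \<open>i\<close> and \<open>j\<close> are adjacent
  iff the weight is positive.\<close>

definition dual_weight ::
    "('v, 'e) mgraph \<Rightarrow> (nat \<Rightarrow> ('e \<times> real) set) \<Rightarrow> nat \<Rightarrow> nat \<Rightarrow> real" where
  "dual_weight G C i j = (if i = j then 0 else mg_length G (C i \<inter> C j))"

definition weighted_degree :: "'a set \<Rightarrow> ('a \<Rightarrow> 'a \<Rightarrow> real) \<Rightarrow> 'a \<Rightarrow> real" where
  "weighted_degree V \<mu> v = (\<Sum>w\<in>V. \<mu> v w)"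

text \<open>Functions on the vertex set \<open>V\<close> are represented by functions vanishing outside \<open>V\<close>.\<close>

definition normalized_laplacian ::
    "'a set \<Rightarrow> ('a \<Rightarrow> 'a \<Rightarrow> real) \<Rightarrow> ('a \<Rightarrow> real) \<Rightarrow> ('a \<Rightarrow> real) \<Rightarrow> bool" where
  "normalized_laplacian V \<mu> f u \<longleftrightarrow>
     (\<forall>v. v \<notin> V \<longrightarrow> f v = 0 \<and> u v = 0) \<and>
     (\<forall>v\<in>V. u v = 1 / weighted_degree V \<mu> v * (\<Sum>w\<in>V. \<mu> v w * (f v - f w)))"

end

(*
  On a cycle of length L the periodic Wirtinger inequality bounds the energy of f from below by
  (2 pi / L)^2 times the squared distance of f from its mean. Summed over a double cover this gives
  energy(f) >= 2 pi^2 min_j |C_j|^-2 (2 |f|^2 - |P f|^2), where P sends f to the vector of its means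
  over the cycles, weighted by the cycle lengths. Since these lengths are the weighted degrees of the
  dual graph, P P* = 2 - Lambda, so |P f|^2 <= (2 - a) |f|^2 as soon as P f is orthogonal to all
  eigenvectors of Lambda with eigenvalue at most a. If a lies below the i-th eigenvalue of Lambda,
  these are fewer than i linear conditions, so they can be met by some f <> 0 in the span of i
  eigenfunctions of the metric graph with eigenvalues at most t, whose energy is at most t |f|^2.
*)

theory Submission imports Defs begin

text \<open>The two spectra enter asymmetrically. On the metric graph an upper bound for the energy
  is enough, and it comes from eigenfunctions that are given: Green's formula makes different
  eigenspaces orthogonal and the energy diagonal on their sum. On the dual graph the opposite
  estimate is required: the quadratic form must exceed \<open>a\<close> on everything orthogonal to
  the low modes, which is obtained by minimising the Rayleigh quotient there.

  The identity for the normalized Laplacian bounds the adjoint of P at the single vector m = P f.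
  Turning this into a bound for P f itself is a completed square on each edge, followed by a
  division by 2 - a; hence a < 2 has to be secured beforehand.

  The constant (2 pi / L)^2 is the lowest Dirichlet eigenvalue of an interval of length L / 2. This
  is why a cycle is cut at two antipodal points where the function takes the same value.\<close>

section \<open>Homogeneous linear systems\<close>

text \<open>Gaussian elimination, one equation and one unknown at a time. Every dimension count
  below is reduced to this statement; arbitrary index types allow the unknowns to be indexed by
  vertices, by functions or by pairs of an eigenvalue and a basis vector.\<close>

lemma homogeneous_system_nontrivial:
  fixes M :: "'r \<Rightarrow> 'b \<Rightarrow> real"
  assumes "finite R" "finite B" "card R < card B"
  shows "\<exists>c. (\<exists>b\<in>B. c b \<noteq> 0) \<and> (\<forall>r\<in>R. (\<Sum>b\<in>B. M r b * c b) = 0)"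
  using assms
proof (induction R arbitrary: B M rule: finite_induct)
  case empty
  then have "B \<noteq> {}" by auto
  then show ?case by (intro exI[of _ "\<lambda>_. 1"]) auto
next
  case (insert r R)
  show ?case
  proof (cases "\<forall>b\<in>B. M r b = 0")
    case True
    obtain c where "\<exists>b\<in>B. c b \<noteq> 0" "\<forall>r\<in>R. (\<Sum>b\<in>B. M r b * c b) = 0"
      using insert.IH[of B M] insert.prems insert.hyps by auto
    then show ?thesis using True by (intro exI[of _ c]) auto
  next
    case False
    then obtain b0 where b0: "b0 \<in> B" "M r b0 \<noteq> 0" by blast
    define B' where "B' = B - {b0}"
    have B': "finite B'" "b0 \<notin> B'" "B = insert b0 B'" "card R < card B'"
      using insert.prems insert.hyps b0 by (auto simp: B'_def)
    \<comment> \<open>Subtracting \<open>q r'\<close> times row \<open>r\<close> from row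
      \<open>r'\<close> clears the column of the pivot \<open>b0\<close>.\<close>
    define q where "q r' = M r' b0 / M r b0" for r'
    obtain c where c: "\<exists>b\<in>B'. c b \<noteq> 0"
      "\<forall>r'\<in>R. (\<Sum>b\<in>B'. (M r' b - q r' * M r b) * c b) = 0"
      using insert.IH[of B' "\<lambda>r' b. M r' b - q r' * M r b"] B' by auto
    \<comment> \<open>Back substitution: the value at \<open>b0\<close> is the one that solves
      equation \<open>r\<close>.\<close>
    define c' where "c' = c(b0 := - (\<Sum>b\<in>B'. M r b * c b) / M r b0)"
    have sum': "(\<Sum>b\<in>B. M r' b * c' b) = M r' b0 * c' b0 + (\<Sum>b\<in>B'. M r' b * c b)" for r'
    proof -
      have "(\<Sum>b\<in>B'. M r' b * c' b) = (\<Sum>b\<in>B'. M r' b * c b)"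
        using B'(2) by (intro sum.cong) (auto simp: c'_def)
      then show ?thesis using B' by simp
    qed
    have "(\<Sum>b\<in>B. M r' b * c' b) = 0" if "r' \<in> insert r R" for r'
    proof (cases "r' = r")
      case True
      then show ?thesis using b0 unfolding sum' by (simp add: c'_def)
    next
      case False
      then have "(\<Sum>b\<in>B'. (M r' b - q r' * M r b) * c b) = 0" using c that by auto
      then have "(\<Sum>b\<in>B'. M r' b * c b) = q r' * (\<Sum>b\<in>B'. M r b * c b)"
        by (simp add: left_diff_distrib sum_subtractf sum_distrib_left mult.assoc)
      then show ?thesis unfolding sum' by (simp add: c'_def q_def)
    qed
    moreover have "\<exists>b\<in>B. c' b \<noteq> 0" using c(1) B' by (auto simp: c'_def)
    ultimately show ?thesis by blast
  qed
qed

section \<open>A periodic Wirtinger inequality\<close>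

text \<open>The numbers describe a continuous, piecewise differentiable function on \<open>{0..L}\<close>: its boundary
  values \<open>a\<close> and \<open>b\<close>, its integral \<open>I\<close>, and the integrals \<open>K\<close> and \<open>D\<close> of its square and of the square of
  its derivative. Working with them avoids handling the concatenation of functions along a cycle.\<close>

definition profile :: "real \<Rightarrow> real \<Rightarrow> real \<Rightarrow> real \<Rightarrow> real \<Rightarrow> real \<Rightarrow> bool" where
  "profile L a b I K D \<longleftrightarrow>
     (\<exists>F G S. finite S \<and> continuous_on {0..L} F \<and>
        (\<forall>x\<in>{0<..<L} - S. (F has_real_derivative G x) (at x)) \<and> F 0 = a \<and> F L = b \<and>
        (F has_integral I) {0..L} \<and> ((\<lambda>x. (F x)\<^sup>2) has_integral K) {0..L} \<and>
        ((\<lambda>x. (G x)\<^sup>2) has_integral D) {0..L})"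

lemma has_integral_reflect_about:
  fixes f :: "real \<Rightarrow> real"
  assumes "(f has_integral I) {0..L}" "0 \<le> L"
  shows "((\<lambda>x. f (L - x)) has_integral I) {0..L}"
proof -
  have "bij_betw (\<lambda>x::real. L - x) {0..L} {0..L}"
    by (rule bij_betwI[where g = "\<lambda>x. L - x"]) auto
  then have "(\<lambda>x::real. L - x) ` {0..L} = {0..L}" by (simp add: bij_betw_def)
  then show ?thesis
    using has_integral_affinity[of f I 0 L "-1" L] assms by (simp add: algebra_simps)
qed

lemma has_integral_translate:
  fixes f :: "real \<Rightarrow> real"
  assumes "(f has_integral I) {0..L}"
  shows "((\<lambda>x. f (x - a)) has_integral I) {a..a + L}"
  using has_integral_affinity[of f I 0 L "1" "-a"] assms by (simp add: algebra_simps)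

text \<open>A cycle may run through an edge against its parametrisation. Reflection changes the sign
  of the derivative, which \<open>D\<close> does not see.\<close>

lemma profile_rev:
  assumes "profile L a b I K D" "0 \<le> L"
  shows "profile L b a I K D"
proof -
  obtain F G S where FG: "finite S" "continuous_on {0..L} F"
    "\<forall>x\<in>{0<..<L} - S. (F has_real_derivative G x) (at x)" "F 0 = a" "F L = b"
    "(F has_integral I) {0..L}" "((\<lambda>x. (F x)\<^sup>2) has_integral K) {0..L}"
    "((\<lambda>x. (G x)\<^sup>2) has_integral D) {0..L}"
    using assms unfolding profile_def by blast
  have "((\<lambda>x. F (L - x)) has_real_derivative - G (L - x)) (at x)"
    if "x \<in> {0<..<L} - (\<lambda>x. L - x) ` S" for x
  proof -
    have "L - x \<in> {0<..<L} - S" using that by (force simp: image_iff)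
    then have "(F has_real_derivative G (L - x)) (at (L - x))" using FG(3) by blast
    moreover have "((\<lambda>x. L - x) has_real_derivative -1) (at x)"
      by (auto intro!: derivative_eq_intros)
    ultimately show ?thesis using DERIV_chain2[of F "G (L - x)" "\<lambda>x. L - x" x "-1"] by simp
  qed
  moreover have "continuous_on {0..L} (\<lambda>x. F (L - x))"
    by (rule continuous_on_compose2[OF FG(2)]) (auto intro!: continuous_intros)
  ultimately show ?thesis
    unfolding profile_def
    using FG has_integral_reflect_about[OF _ assms(2)]
    by (intro exI[of _ "\<lambda>x. F (L - x)"] exI[of _ "\<lambda>x. - G (L - x)"] exI[of _ "(\<lambda>x. L - x) ` S"]) auto
qed

lemma has_integral_join:
  fixes f g :: "real \<Rightarrow> real"
  assumes "(f has_integral I) {0..L}" "(g has_integral J) {0..M}" "0 \<le> L" "0 \<le> M"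
  shows "((\<lambda>x. if x \<le> L then f x else g (x - L)) has_integral (I + J)) {0..L + M}"
proof (rule has_integral_combine[of 0 L])
  show "((\<lambda>x. if x \<le> L then f x else g (x - L)) has_integral I) {0..L}"
    using assms(1) by (rule has_integral_eq[rotated]) auto
  \<comment> \<open>At the seam \<open>x = L\<close> the definition takes the value of
    \<open>f\<close> instead of \<open>g 0\<close>; a single point does not affect the
    integral.\<close>
  show "((\<lambda>x. if x \<le> L then f x else g (x - L)) has_integral J) {L..L + M}"
    by (rule has_integral_spike_finite[OF _ _ has_integral_translate[OF assms(2)], of "{L}"]) auto
qed (use assms in auto)

text \<open>The shared boundary value \<open>b\<close> makes the concatenation continuous. The
  one-sided derivatives at the joint may differ, so \<open>L\<close> joins the finite exceptional
  set; this is what \<open>S\<close> in \<open>profile\<close> is for.\<close>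

lemma profile_append:
  assumes P: "profile L a b I K D" "profile L' b c I' K' D'" and L: "0 \<le> L" "0 \<le> L'"
  shows "profile (L + L') a c (I + I') (K + K') (D + D')"
proof -
  obtain F G S where FG: "finite S" "continuous_on {0..L} F"
    "\<forall>x\<in>{0<..<L} - S. (F has_real_derivative G x) (at x)" "F 0 = a" "F L = b"
    "(F has_integral I) {0..L}" "((\<lambda>x. (F x)\<^sup>2) has_integral K) {0..L}"
    "((\<lambda>x. (G x)\<^sup>2) has_integral D) {0..L}"
    using P unfolding profile_def by blast
  obtain F' G' S' where FG': "finite S'" "continuous_on {0..L'} F'"
    "\<forall>x\<in>{0<..<L'} - S'. (F' has_real_derivative G' x) (at x)" "F' 0 = b" "F' L' = c"
    "(F' has_integral I') {0..L'}" "((\<lambda>x. (F' x)\<^sup>2) has_integral K') {0..L'}"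
    "((\<lambda>x. (G' x)\<^sup>2) has_integral D') {0..L'}"
    using P unfolding profile_def by blast
  define H where "H x = (if x \<le> L then F x else F' (x - L))" for x
  define h where "h x = (if x \<le> L then G x else G' (x - L))" for x
  define T where "T = S \<union> {L} \<union> (\<lambda>x. x + L) ` S'"
  have "finite T" using FG FG' by (auto simp: T_def)
  moreover have "continuous_on {0..L + L'} H"
  proof -
    have "continuous_on ({0..L} \<union> {L..L + L'}) (\<lambda>x. if x \<le> L then F x else F' (x - L))"
      using FG FG' by (intro continuous_on_If)
        (auto intro!: continuous_on_compose2[OF FG'(2)] continuous_intros)
    moreover have "{0..L} \<union> {L..L + L'} = {0..L + L'}" using L by auto
    ultimately show ?thesis by (simp add: H_def)
  qed
  moreover have "(H has_real_derivative h x) (at x)" if x: "x \<in> {0<..<L + L'} - T" for x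
  proof (cases "x < L")
    case True
    have "(F has_real_derivative G x) (at x)" using FG(3) x True by (auto simp: T_def)
    then have "(H has_real_derivative G x) (at x)"
      by (rule has_field_derivative_transform_within_open[of _ _ _ "{..<L}"])
        (auto simp: H_def True)
    then show ?thesis using True by (simp add: h_def)
  next
    case False
    then have gt: "x > L" using x by (auto simp: T_def)
    have "x - L \<in> {0<..<L'} - S'" using x gt by (force simp: T_def image_iff)
    then have "(F' has_real_derivative G' (x - L)) (at (x - L))" using FG'(3) by blast
    then have "((\<lambda>x. F' (x - L)) has_real_derivative G' (x - L)) (at x)"
      using DERIV_shift[of F' "G' (x - L)" x "- L"] by simp
    then have "(H has_real_derivative G' (x - L)) (at x)"
      by (rule has_field_derivative_transform_within_open[of _ _ _ "{L<..}"])
        (auto simp: H_def gt)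
    then show ?thesis using gt by (simp add: h_def)
  qed
  moreover have "H 0 = a" "H (L + L') = c" using FG FG' L by (auto simp: H_def)
  moreover have "(H has_integral (I + I')) {0..L + L'}"
    using has_integral_join[OF FG(6) FG'(6) L] by (rule has_integral_eq[rotated]) (simp add: H_def)
  moreover have "((\<lambda>x. (H x)\<^sup>2) has_integral (K + K')) {0..L + L'}"
    using has_integral_join[OF FG(7) FG'(7) L] by (rule has_integral_eq[rotated]) (simp add: H_def)
  moreover have "((\<lambda>x. (h x)\<^sup>2) has_integral (D + D')) {0..L + L'}"
    using has_integral_join[OF FG(8) FG'(8) L] by (rule has_integral_eq[rotated]) (simp add: h_def)
  ultimately show ?thesis unfolding profile_def by blast
qed

text \<open>Picone's identity: \<open>u'\<^sup>2 - w\<^sup>2 u\<^sup>2 - (w u\<^sup>2 cot)' = (u' - w u cot)\<^sup>2\<close>. The phase \<open>\<beta>\<close> keeps the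
  cotangent away from its poles, also at the end points.\<close>

lemma integral_deriv_square_ge:
  fixes u G :: "real \<Rightarrow> real"
  assumes ab: "a \<le> b" and cont: "continuous_on {a..b} u" and S: "finite S"
    and der: "\<And>x. x \<in> {a<..<b} - S \<Longrightarrow> (u has_real_derivative G x) (at x)"
    and int: "(\<lambda>x. (G x)\<^sup>2) integrable_on {a..b}"
    and phase: "\<And>x. x \<in> {a..b} \<Longrightarrow> 0 < w * x + \<beta> \<and> w * x + \<beta> < pi"
  shows "w * (u b)\<^sup>2 * cot (w * b + \<beta>) - w * (u a)\<^sup>2 * cot (w * a + \<beta>)
    \<le> integral {a..b} (\<lambda>x. (G x)\<^sup>2) - w\<^sup>2 * integral {a..b} (\<lambda>x. (u x)\<^sup>2)"
proof -
  let ?B = "\<lambda>x. w * (u x)\<^sup>2 * cot (w * x + \<beta>)"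
  let ?B' = "\<lambda>x. 2 * w * u x * G x * cot (w * x + \<beta>) - w\<^sup>2 * (u x)\<^sup>2 * (1 + (cot (w * x + \<beta>))\<^sup>2)"
  have sin0: "sin (w * x + \<beta>) \<noteq> 0" if "x \<in> {a..b}" for x
    using sin_gt_zero[of "w * x + \<beta>"] phase[OF that] by auto
  have "(?B' has_integral (?B b - ?B a)) {a..b}"
  proof (rule fundamental_theorem_of_calculus_interior_strong[OF S ab])
    show "continuous_on {a..b} ?B"
      unfolding cot_def using sin0 by (intro continuous_intros cont) auto
    fix x assume x: "x \<in> {a<..<b} - S"
    then have s: "sin (w * x + \<beta>) \<noteq> 0" using sin0 by auto
    have inv: "inverse ((sin (w * x + \<beta>))\<^sup>2) = 1 + (cot (w * x + \<beta>))\<^sup>2"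
      using s sin_cos_squared_add[of "w * x + \<beta>"] by (simp add: cot_def field_simps)
    have "((\<lambda>x. w * x + \<beta>) has_real_derivative w) (at x)"
      by (auto intro!: derivative_eq_intros)
    from DERIV_chain2[OF DERIV_cot[OF s] this]
    have "((\<lambda>x. cot (w * x + \<beta>)) has_real_derivative - (1 + (cot (w * x + \<beta>))\<^sup>2) * w) (at x)"
      by (simp add: inv)
    moreover have "((\<lambda>x. w * (u x)\<^sup>2) has_real_derivative 2 * w * u x * G x) (at x)"
      by (auto intro!: derivative_eq_intros der[OF x])
    from DERIV_mult[OF this calculation]
    have "(?B has_real_derivative 2 * w * u x * G x * cot (w * x + \<beta>) +
        - (1 + (cot (w * x + \<beta>))\<^sup>2) * w * (w * (u x)\<^sup>2)) (at x)" .
    moreover have "2 * w * u x * G x * cot (w * x + \<beta>) +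
        - (1 + (cot (w * x + \<beta>))\<^sup>2) * w * (w * (u x)\<^sup>2) = ?B' x"
      by (simp add: power2_eq_square algebra_simps)
    ultimately have "(?B has_real_derivative ?B' x) (at x)" by (simp only:)
    then show "(?B has_vector_derivative ?B' x) (at x)"
      by (simp add: has_real_derivative_iff_has_vector_derivative)
  qed
  moreover have "(\<lambda>x. (u x)\<^sup>2) integrable_on {a..b}"
    by (intro integrable_continuous_real continuous_intros cont)
  then have "((\<lambda>x. (G x)\<^sup>2 - w\<^sup>2 * (u x)\<^sup>2) has_integral
      (integral {a..b} (\<lambda>x. (G x)\<^sup>2) - w\<^sup>2 * integral {a..b} (\<lambda>x. (u x)\<^sup>2))) {a..b}"
    using int by (intro has_integral_diff has_integral_mult_right integrable_integral)
  moreover have "?B' x \<le> (G x)\<^sup>2 - w\<^sup>2 * (u x)\<^sup>2" for x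
  proof -
    have "(G x)\<^sup>2 - w\<^sup>2 * (u x)\<^sup>2 - ?B' x = (G x - w * u x * cot (w * x + \<beta>))\<^sup>2"
      by (simp add: power2_eq_square algebra_simps)
    then show ?thesis by (metis diff_ge_0_iff_ge zero_le_power2)
  qed
  ultimately show ?thesis by (rule has_integral_le)
qed

text \<open>By the intermediate value theorem \<open>F\<close> takes the same value \<open>c\<close> at two antipodal points. They split
  the circle into two intervals of length \<open>L / 2\<close> on which \<open>F - c\<close> satisfies Dirichlet conditions; the
  second one passes through the point \<open>0 = L\<close>, where the boundary terms cancel.\<close>

lemma periodic_wirtinger_shifted:
  fixes F G :: "real \<Rightarrow> real"
  assumes L: "0 < L" and cont: "continuous_on {0..L} F" and S: "finite S"
    and der: "\<And>x. x \<in> {0<..<L} - S \<Longrightarrow> (F has_real_derivative G x) (at x)"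
    and int: "(\<lambda>x. (G x)\<^sup>2) integrable_on {0..L}" and per: "F 0 = F L"
  shows "\<exists>c. (2 * pi / L)\<^sup>2 * integral {0..L} (\<lambda>x. (F x - c)\<^sup>2) \<le> integral {0..L} (\<lambda>x. (G x)\<^sup>2)"
proof -
  let ?H = "\<lambda>x. F (x + L / 2) - F x"
  have "continuous_on {0..L / 2} ?H"
    using L by (intro continuous_on_diff continuous_on_compose2[OF cont] continuous_intros) auto
  then have "connected (?H ` {0..L / 2})" by (rule connected_continuous_image) auto
  \<comment> \<open>Periodicity makes the antipodal difference change sign between 0 and
    \<open>L / 2\<close>, so it has a zero \<open>x0\<close>.\<close>
  moreover have "?H (L / 2) = - ?H 0" using per by simp
  then have "?H (L / 2) \<le> 0 \<and> 0 \<le> ?H 0 \<or> ?H 0 \<le> 0 \<and> 0 \<le> ?H (L / 2)" by linarith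
  moreover have "?H 0 \<in> ?H ` {0..L / 2}" "?H (L / 2) \<in> ?H ` {0..L / 2}"
    using L by (intro imageI; simp)+
  ultimately have "0 \<in> ?H ` {0..L / 2}"
    by (meson connectedD_interval)
  then obtain x0 where x0: "0 \<le> x0" "x0 \<le> L / 2" "F (x0 + L / 2) = F x0" by auto
  define c where "c = F x0"
  define u where "u x = F x - c" for x
  have u0: "u x0 = 0" "u (x0 + L / 2) = 0" "u L = u 0" using x0 per by (auto simp: u_def c_def)
  have ucont: "continuous_on {0..L} u" unfolding u_def by (intro continuous_intros cont)
  have uder: "(u has_real_derivative G x) (at x)" if "x \<in> {0<..<L} - S" for x
    unfolding u_def using der[OF that] by (auto intro!: derivative_eq_intros)
  let ?I = "\<lambda>a b. integral {a..b} (\<lambda>x. (G x)\<^sup>2)" and ?J = "\<lambda>a b. integral {a..b} (\<lambda>x. (u x)\<^sup>2)"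
  have u2: "(\<lambda>x. (u x)\<^sup>2) integrable_on {0..L}"
    by (intro integrable_continuous_real continuous_intros ucont)
  have split: "integral {0..L} f = integral {0..x0} f + integral {x0..x0 + L / 2} f +
      integral {x0 + L / 2..L} f" if "f integrable_on {0..L}" for f :: "real \<Rightarrow> real"
  proof -
    have "integral {0..x0} f + integral {x0..L} f = integral {0..L} f"
      using x0 L that by (intro Henstock_Kurzweil_Integration.integral_combine) auto
    moreover have "integral {x0..x0 + L / 2} f + integral {x0 + L / 2..L} f = integral {x0..L} f"
      using x0 L by (intro Henstock_Kurzweil_Integration.integral_combine
        integrable_on_subinterval[OF that]) auto
    ultimately show ?thesis by linarith
  qed
  have sub: "w\<^sup>2 * ?J 0 L \<le> ?I 0 L" if w: "0 < w" "w < 2 * pi / L" for w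
  proof -
    \<comment> \<open>For \<open>w\<close> strictly below \<open>2 * pi / L\<close>, half a period
      uses only \<open>w * L / 2 < pi\<close> of the interval between two poles of the cotangent.
      Half of the slack is left as a margin \<open>d\<close> at either end.\<close>
    define d where "d = (pi - w * L / 2) / 2"
    have wL: "w * L < 2 * pi" using w L by (simp add: field_simps)
    have d: "0 < d" "w * (L / 2) + d = pi - d" using wL by (auto simp: d_def field_simps)
    have ph: "0 < w * y + d \<and> w * y + d < pi" if "0 \<le> y" "y \<le> L / 2" for y
    proof -
      have "0 \<le> w * y" "w * y \<le> w * (L / 2)" using that w by (auto intro: mult_left_mono)
      then show ?thesis using d by linarith
    qed
    \<comment> \<open>The shift \<open>s\<close> moves the argument of the cotangent, so that
      adjacent pieces of the circle can share one continuous phase running over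
      \<open>{0..L / 2}\<close>.\<close>
    have piece: "w * (u b)\<^sup>2 * cot (w * (b + s) + d) - w * (u a)\<^sup>2 * cot (w * (a + s) + d)
        \<le> ?I a b - w\<^sup>2 * ?J a b"
      if "0 \<le> a" "a \<le> b" "b \<le> L" "0 \<le> a + s" "b + s \<le> L / 2" for a b s
    proof -
      have "w * (u b)\<^sup>2 * cot (w * b + (w * s + d)) - w * (u a)\<^sup>2 * cot (w * a + (w * s + d))
        \<le> ?I a b - w\<^sup>2 * ?J a b"
      proof (rule integral_deriv_square_ge[OF \<open>a \<le> b\<close> _ S])
        show "continuous_on {a..b} u" by (rule continuous_on_subset[OF ucont]) (use that in auto)
        show "(u has_real_derivative G x) (at x)" if "x \<in> {a<..<b} - S" for x
          by (rule uder) (use that \<open>0 \<le> a\<close> \<open>b \<le> L\<close> in auto)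
        show "(\<lambda>x. (G x)\<^sup>2) integrable_on {a..b}"
          by (rule integrable_on_subinterval[OF int]) (use that in auto)
        show "0 < w * x + (w * s + d) \<and> w * x + (w * s + d) < pi" if "x \<in> {a..b}" for x
          using ph[of "x + s"] that \<open>0 \<le> a + s\<close> \<open>b + s \<le> L / 2\<close> by (simp add: algebra_simps)
      qed
      then show ?thesis by (simp add: algebra_simps)
    qed
    have "0 \<le> ?I x0 (x0 + L / 2) - w\<^sup>2 * ?J x0 (x0 + L / 2)"
      using piece[of x0 "x0 + L / 2" "- x0"] x0 L u0 by simp
    \<comment> \<open>The half circle through the point \<open>0 = L\<close>: its first piece
      carries the phase from 0 to \<open>L / 2 - x0\<close>, and the next piece, on
      \<open>{0..x0}\<close>, continues from there to \<open>L / 2\<close>. As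
      \<open>u L = u 0\<close>, the two boundary terms at the cut are opposite.\<close>
    moreover have "w * (u 0)\<^sup>2 * cot (w * (L / 2 - x0) + d) \<le> ?I (x0 + L / 2) L - w\<^sup>2 * ?J (x0 + L / 2) L"
      using piece[of "x0 + L / 2" L "- x0 - L / 2"] x0 L u0 by simp
    moreover have "- (w * (u 0)\<^sup>2 * cot (w * (L / 2 - x0) + d)) \<le> ?I 0 x0 - w\<^sup>2 * ?J 0 x0"
      using piece[of 0 x0 "L / 2 - x0"] x0 L u0 by simp
    ultimately show ?thesis
      unfolding split[OF u2] split[OF int] by (simp add: algebra_simps)
  qed
  \<comment> \<open>The critical frequency itself is reached as a limit from the left.\<close>
  have "(2 * pi / L)\<^sup>2 * ?J 0 L \<le> ?I 0 L"
  proof (rule tendsto_upperbound)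
    show "((\<lambda>w. w\<^sup>2 * ?J 0 L) \<longlongrightarrow> (2 * pi / L)\<^sup>2 * ?J 0 L) (at_left (2 * pi / L))"
      by (intro tendsto_intros)
    show "\<forall>\<^sub>F w in at_left (2 * pi / L). w\<^sup>2 * ?J 0 L \<le> ?I 0 L"
      using sub L by (intro eventually_at_leftI[of 0]) auto
  qed simp
  then show ?thesis by (auto simp: u_def)
qed

text \<open>Among all constants \<open>c\<close> the mean \<open>I / L\<close> minimises the
  integral of \<open>(F x - c)\<^sup>2\<close>, with minimum \<open>K - I\<^sup>2 / L\<close>. The
  unspecified constant of \<open>periodic_wirtinger_shifted\<close> may therefore be replaced by the
  mean.\<close>

lemma profile_wirtinger:
  assumes "profile L a a I K D" "0 < L"
  shows "(2 * pi / L)\<^sup>2 * (K - I\<^sup>2 / L) \<le> D"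
proof -
  obtain F G S where FG: "finite S" "continuous_on {0..L} F"
    "\<forall>x\<in>{0<..<L} - S. (F has_real_derivative G x) (at x)" "F 0 = a" "F L = a"
    "(F has_integral I) {0..L}" "((\<lambda>x. (F x)\<^sup>2) has_integral K) {0..L}"
    "((\<lambda>x. (G x)\<^sup>2) has_integral D) {0..L}"
    using assms unfolding profile_def by blast
  have "\<exists>c. (2 * pi / L)\<^sup>2 * integral {0..L} (\<lambda>x. (F x - c)\<^sup>2) \<le> integral {0..L} (\<lambda>x. (G x)\<^sup>2)"
    by (rule periodic_wirtinger_shifted[OF assms(2) FG(2,1)]) (use FG in auto)
  then obtain c where c: "(2 * pi / L)\<^sup>2 * integral {0..L} (\<lambda>x. (F x - c)\<^sup>2) \<le> D"
    using FG(8) by (auto simp: integral_unique)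
  have "((\<lambda>x. (F x)\<^sup>2 - 2 * c * F x + c\<^sup>2) has_integral (K - 2 * c * I + c\<^sup>2 * L)) {0..L}"
    using has_integral_const_real[of "c\<^sup>2" 0 L] assms(2) FG(6,7)
    by (intro has_integral_add has_integral_diff has_integral_mult_right) (auto simp: mult.commute)
  moreover have "(\<lambda>x. (F x)\<^sup>2 - 2 * c * F x + c\<^sup>2) = (\<lambda>x. (F x - c)\<^sup>2)"
    by (auto simp: power2_eq_square algebra_simps)
  ultimately have J: "integral {0..L} (\<lambda>x. (F x - c)\<^sup>2) = K - 2 * c * I + c\<^sup>2 * L"
    by (simp add: integral_unique)
  have "K - 2 * c * I + c\<^sup>2 * L - (K - I\<^sup>2 / L) = (I - c * L)\<^sup>2 / L"
    using assms(2) by (simp add: field_simps power2_eq_square)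
  also have "\<dots> \<ge> 0" using assms(2) by simp
  finally have "K - I\<^sup>2 / L \<le> integral {0..L} (\<lambda>x. (F x - c)\<^sup>2)" unfolding J by simp
  then have "(2 * pi / L)\<^sup>2 * (K - I\<^sup>2 / L) \<le> (2 * pi / L)\<^sup>2 * integral {0..L} (\<lambda>x. (F x - c)\<^sup>2)"
    by (intro mult_left_mono) auto
  then show ?thesis using c by linarith
qed

section \<open>Eigenfunctions of the metric graph\<close>

context metric_graph
begin

lemma edge_points_in_sets:
  assumes "A \<subseteq> edges G"
  shows "edge_points G A \<in> sets (count_space (edges G) \<Otimes>\<^sub>M lborel)"
proof -
  have "edge_points G A = (\<Union>e\<in>A. {e} \<times> {0..len G e})"
    by (auto simp: edge_points_def)
  moreover have "finite A" using assms finite_edges finite_subset by blast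
  ultimately show ?thesis
    using assms by (auto intro!: sets.finite_UN pair_measureI)
qed

lemma mg_length_edge_points:
  assumes "A \<subseteq> edges G"
  shows "mg_length G (edge_points G A) = (\<Sum>e\<in>A. len G e)"
proof -
  let ?P = "count_space (edges G) \<Otimes>\<^sub>M (lborel :: real measure)"
  have A: "finite A" using assms finite_edges finite_subset by blast
  have sub: "edge_points G A \<subseteq> edge_points G (edges G)" using assms by (auto simp: edge_points_def)
  have sp: "space ?P = edges G \<times> UNIV" by (simp add: space_pair_measure)
  have "emeasure (mg_measure G) (edge_points G A) = emeasure ?P (edge_points G A)"
    unfolding mg_measure_def using sub edge_points_in_sets[of "edges G"]
    by (intro emeasure_restrict_space) (auto simp: sp Int_absorb2 edge_points_def)
  also have "edge_points G A = (\<Union>e\<in>A. {e} \<times> {0..len G e})"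
    by (auto simp: edge_points_def)
  also have "emeasure ?P \<dots> = (\<Sum>e\<in>A. emeasure ?P ({e} \<times> {0..len G e}))"
    using assms A by (intro sum_emeasure[symmetric]) (auto simp: disjoint_family_on_def)
  also have "\<dots> = (\<Sum>e\<in>A. ennreal (len G e))"
  proof (intro sum.cong refl)
    fix e assume "e \<in> A"
    then have e: "e \<in> edges G" using assms by auto
    have "emeasure ?P ({e} \<times> {0..len G e}) =
        emeasure (count_space (edges G)) {e} * emeasure lborel {0..len G e}"
      using e by (intro lborel.emeasure_pair_measure_Times) auto
    then show "emeasure ?P ({e} \<times> {0..len G e}) = ennreal (len G e)"
      using e len_pos[OF e] by (simp add: less_imp_le)
  qed
  also have "\<dots> = ennreal (\<Sum>e\<in>A. len G e)"
    using assms len_pos by (intro sum_ennreal) (auto intro: less_imp_le)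
  finally have "emeasure (mg_measure G) (edge_points G A) = ennreal (\<Sum>e\<in>A. len G e)"
    unfolding edge_points_def Sigma_def by simp
  then show ?thesis
    unfolding mg_length_def using assms len_pos
    by (intro measure_eq_emeasure_eq_ennreal sum_nonneg) (auto intro: less_imp_le)
qed

text \<open>Fubini for null sets yields the claim for almost every edge, and for the counting
  measure that is every edge.\<close>

lemma AE_mg_measure_edge:
  assumes "AE z in mg_measure G. P z" "e \<in> edges G"
  shows "AE x in lborel. x \<in> {0..len G e} \<longrightarrow> P (e, x)"
proof -
  let ?P = "count_space (edges G) \<Otimes>\<^sub>M (lborel :: real measure)"
  have "AE z in ?P. z \<in> edge_points G (edges G) \<longrightarrow> P z"
    using assms(1) edge_points_in_sets[of "edges G"] unfolding mg_measure_def
    by (subst (asm) AE_restrict_space_iff) (auto simp: space_pair_measure Int_absorb2 edge_points_def)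
  moreover interpret pair_sigma_finite "count_space (edges G)" "lborel :: real measure"
    using sigma_finite_measure_count_space_finite[OF finite_edges] lborel.sigma_finite_measure_axioms
    by (simp add: pair_sigma_finite_def)
  from AE_pair[OF calculation]
  have "AE x in lborel. (e, x) \<in> edge_points G (edges G) \<longrightarrow> P (e, x)"
    using assms(2) by (simp add: AE_count_space)
  then show ?thesis using assms(2) by (simp add: edge_points_def)
qed

text \<open>A condition that is constant along an edge cannot fail there, since the edge has
  positive length. This turns the almost-everywhere covering condition into a combinatorial
  one.\<close>

lemma AE_mg_measure_edge_const:
  assumes "AE z in mg_measure G. P z" "e \<in> edges G"
    and "\<And>x. x \<in> {0..len G e} \<Longrightarrow> P (e, x) \<longleftrightarrow> Q"
  shows Q
proof (rule ccontr)
  assume "\<not> Q"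
  then have "AE x in lborel. x \<notin> {0..len G e}"
    using assms(3) by (intro eventually_mono[OF AE_mg_measure_edge[OF assms(1,2)]]) auto
  then have "emeasure lborel {0..len G e} = 0"
    by (subst (asm) AE_iff_measurable[where N = "{0..len G e}"]) auto
  then show False using len_pos[OF assms(2)] by simp
qed

end

section \<open>From Sobolev functions to classical derivatives\<close>

text \<open>On a bounded interval square integrability implies integrability, so the Lebesgue
  primitive is also a gauge integral and depends continuously on its end point.\<close>

lemma H1_deriv_integral:
  assumes "H1_deriv l f g"
  shows "continuous_on {0..l} f"
    "\<And>x. x \<in> {0..l} \<Longrightarrow> f x = f 0 + integral {0..x} g"
proof -
  have d: "(set_borel_measurable lborel {0..l} g \<and> set_integrable lborel {0..l} (\<lambda>x. (g x)\<^sup>2)) \<and>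
      (\<forall>x\<in>{0..l}. f x = f 0 + (LINT t:{0..x}|lborel. g t))"
    using assms unfolding H1_deriv_def L2_interval_def .
  note meas = d[THEN conjunct1, THEN conjunct1] and sq = d[THEN conjunct1, THEN conjunct2]
    and f = d[THEN conjunct2, rule_format]
  have one: "set_integrable lborel {0..l} (\<lambda>x. 1 :: real)"
    by (rule borel_integrable_atLeastAtMost') auto
  have gi: "set_integrable lborel {0..l} g"
  proof (rule set_integrable_bound[OF set_integral_add(1)[OF sq one] meas])
    show "AE x in lborel. x \<in> {0..l} \<longrightarrow> norm (g x) \<le> norm ((g x)\<^sup>2 + 1)"
    proof (intro AE_I2 impI)
      fix x
      \<comment> \<open>Expanding this square gives
        \<open>\<bar>g x\<bar> \<le> (g x)\<^sup>2 + 1 / 4\<close>.\<close>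
      have "0 \<le> (\<bar>g x\<bar> - 1 / 2)\<^sup>2" by simp
      then show "norm (g x) \<le> norm ((g x)\<^sup>2 + 1)"
        by (simp add: power2_eq_square algebra_simps)
    qed
  qed
  have int: "g integrable_on {0..l}" using set_borel_integral_eq_integral(1)[OF gi] .
  show fx: "f x = f 0 + integral {0..x} g" if "x \<in> {0..l}" for x
  proof -
    have "set_integrable lborel {0..x} g"
      by (rule set_integrable_subset[OF gi]) (use that in auto)
    then show ?thesis using f[OF that] set_borel_integral_eq_integral(2) by simp
  qed
  have "continuous_on {0..l} (\<lambda>x. f 0 + integral {0..x} g)"
    by (intro continuous_intros indefinite_integral_continuous_1 int)
  then show "continuous_on {0..l} f" by (rule continuous_on_eq) (rule fx[symmetric])
qed

text \<open>Changing \<open>g\<close> on a null set leaves its primitive unchanged, and a primitive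
  of the continuous \<open>k\<close> is differentiable. It is applied to \<open>f\<close> with
  \<open>k\<close> the function \<open>g\<close> itself, and to the derivative of \<open>f\<close>
  with \<open>k\<close> equal to \<open>- s * f\<close>, which agrees with the second derivative
  only almost everywhere.\<close>

lemma H1_deriv_imp_DERIV:
  assumes "H1_deriv l f g" "continuous_on {0..l} k" "AE x in lborel. x \<in> {0..l} \<longrightarrow> g x = k x"
    "x \<in> {0..l}"
  shows "(f has_real_derivative k x) (at x within {0..l})"
proof -
  have neg: "negligible {x \<in> {0..l}. g x \<noteq> k x}"
  proof -
    have "AE x in lebesgue. x \<in> {0..l} \<longrightarrow> g x = k x"
      using assms(3) by (rule AE_completion)
    then show ?thesis
    proof (rule AE_E3)
      fix N assume N: "\<And>x. x \<in> space lebesgue - N \<Longrightarrow> x \<in> {0..l} \<longrightarrow> g x = k x"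
        "N \<in> null_sets lebesgue"
      have "negligible N" using N(2) by (simp only: negligible_iff_null_sets)
      moreover have "{x \<in> {0..l}. g x \<noteq> k x} \<subseteq> N"
      proof
        fix x assume x: "x \<in> {x \<in> {0..l}. g x \<noteq> k x}"
        then show "x \<in> N" using N(1)[of x] by (cases "x \<in> N") simp_all
      qed
      ultimately show ?thesis by (rule negligible_subset)
    qed
  qed
  have "integral {0..y} g = integral {0..y} k" if y: "y \<in> {0..l}" for y
  proof (rule integral_spike[OF neg])
    fix x assume "x \<in> {0..y} - {x \<in> {0..l}. g x \<noteq> k x}"
    then show "k x = g x" using y by auto
  qed
  then have eq: "f 0 + integral {0..y} k = f y" if "y \<in> {0..l}" for y
    using H1_deriv_integral(2)[OF assms(1) that] that by presburger
  have "((\<lambda>y. f 0 + integral {0..y} k) has_real_derivative k x) (at x within {0..l})"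
    using DERIV_add[OF DERIV_const integral_has_real_derivative[OF assms(2,4)]] by simp
  then show ?thesis
    by (rule has_field_derivative_transform_within[OF _ zero_less_one assms(4)]) (rule eq)
qed

section \<open>Linear combinations and the edgewise inner product\<close>

interpretation funs: vector_space "\<lambda>(c::real) (f :: 'x \<Rightarrow> real) x. c * f x"
  by unfold_locales (auto simp: fun_eq_iff algebra_simps)

lemma sum_fun_apply: "(\<Sum>b\<in>B. F b) x = (\<Sum>b\<in>B. F b x)" for F :: "'b \<Rightarrow> 'x \<Rightarrow> real"
  by (induction B rule: infinite_finite_induct) auto

lemma funs_independent_lincomb_nonzero:
  fixes B :: "('x \<Rightarrow> real) set"
  assumes "funs.independent B" "finite B" "b \<in> B" "c b \<noteq> 0"
  shows "\<exists>x. (\<Sum>b\<in>B. c b * b x) \<noteq> 0"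
proof (rule ccontr)
  assume "\<not> ?thesis"
  then have "(\<Sum>b\<in>B. (\<lambda>x. c b * b x)) = 0" by (auto simp: fun_eq_iff sum_fun_apply)
  then show False using assms funs.dependent_finite[OF assms(2)] by blast
qed

text \<open>A sum of eigenfunctions for different eigenvalues is no eigenfunction in general. This
  class is closed under such sums and retains what integration by parts and the Wirtinger inequality
  use: the derivative \<open>g\<close> and common values \<open>\<phi>\<close> at the
  vertices.\<close>

definition edgewise_C1 ::
    "('v, 'e) mgraph \<Rightarrow> ('e \<times> real \<Rightarrow> real) \<Rightarrow> ('e \<times> real \<Rightarrow> real) \<Rightarrow> ('v \<Rightarrow> real) \<Rightarrow> bool" where
  "edgewise_C1 G f g \<phi> \<longleftrightarrow>
     (\<forall>e\<in>edges G.
        (\<forall>x\<in>{0..len G e}. ((\<lambda>x. f (e, x)) has_real_derivative g (e, x)) (at x within {0..len G e})) \<and>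
        continuous_on {0..len G e} (\<lambda>x. g (e, x)) \<and>
        f (e, 0) = \<phi> (tail G e) \<and> f (e, len G e) = \<phi> (head G e))"

text \<open>The eigenvalue equation as a classical first-order system for \<open>f\<close> and its
  derivative \<open>g\<close>, together with the Kirchhoff condition.\<close>

definition eigenfunction ::
    "('v, 'e) mgraph \<Rightarrow> real \<Rightarrow> ('e \<times> real \<Rightarrow> real) \<Rightarrow> ('e \<times> real \<Rightarrow> real) \<Rightarrow> ('v \<Rightarrow> real) \<Rightarrow> bool" where
  "eigenfunction G s f g \<phi> \<longleftrightarrow>
     edgewise_C1 G f g \<phi> \<and>
     (\<forall>z. z \<notin> edge_points G (edges G) \<longrightarrow> f z = 0) \<and>
     (\<forall>e\<in>edges G. \<forall>x\<in>{0..len G e}.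
        ((\<lambda>x. g (e, x)) has_real_derivative - s * f (e, x)) (at x within {0..len G e})) \<and>
     (\<forall>v\<in>vertices G.
        (\<Sum>e | e \<in> edges G \<and> tail G e = v. g (e, 0)) +
        (\<Sum>e | e \<in> edges G \<and> head G e = v. - g (e, len G e)) = 0)"

definition edge_inner ::
    "('v, 'e) mgraph \<Rightarrow> ('e \<times> real \<Rightarrow> real) \<Rightarrow> ('e \<times> real \<Rightarrow> real) \<Rightarrow> real" where
  "edge_inner G f h = (\<Sum>e\<in>edges G. integral {0..len G e} (\<lambda>x. f (e, x) * h (e, x)))"

lemma edgewise_C1_continuous:
  assumes "edgewise_C1 G f g \<phi>" "e \<in> edges G"
  shows "continuous_on {0..len G e} (\<lambda>x. f (e, x))" "continuous_on {0..len G e} (\<lambda>x. g (e, x))"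
  using assms unfolding edgewise_C1_def by (auto intro!: DERIV_continuous_on)

lemma edge_inner_commute: "edge_inner G f h = edge_inner G h f"
  unfolding edge_inner_def by (simp add: mult.commute)

lemma edgewise_C1_lincomb:
  assumes "\<And>b. b \<in> B \<Longrightarrow> edgewise_C1 G (f b) (g b) (\<phi> b)"
  shows "edgewise_C1 G (\<lambda>z. \<Sum>b\<in>B. c b * f b z) (\<lambda>z. \<Sum>b\<in>B. c b * g b z) (\<lambda>v. \<Sum>b\<in>B. c b * \<phi> b v)"
  using assms unfolding edgewise_C1_def
  by (auto intro!: DERIV_sum DERIV_cmult continuous_on_sum continuous_on_mult_left)

lemma edge_inner_lincomb_left:
  assumes "finite B" "\<And>b e. b \<in> B \<Longrightarrow> e \<in> edges G \<Longrightarrow> continuous_on {0..len G e} (\<lambda>x. f b (e, x))"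
    "\<And>e. e \<in> edges G \<Longrightarrow> continuous_on {0..len G e} (\<lambda>x. h (e, x))"
  shows "edge_inner G (\<lambda>z. \<Sum>b\<in>B. c b * f b z) h = (\<Sum>b\<in>B. c b * edge_inner G (f b) h)"
proof -
  have "integral {0..len G e} (\<lambda>x. (\<Sum>b\<in>B. c b * f b (e, x)) * h (e, x)) =
      (\<Sum>b\<in>B. c b * integral {0..len G e} (\<lambda>x. f b (e, x) * h (e, x)))" if "e \<in> edges G" for e
  proof -
    have "integral {0..len G e} (\<lambda>x. (\<Sum>b\<in>B. c b * f b (e, x)) * h (e, x)) =
        integral {0..len G e} (\<lambda>x. \<Sum>b\<in>B. c b * (f b (e, x) * h (e, x)))"
      by (simp add: sum_distrib_right mult.assoc)
    also have "\<dots> = (\<Sum>b\<in>B. integral {0..len G e} (\<lambda>x. c b * (f b (e, x) * h (e, x))))"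
      using assms that
      by (intro integral_sum integrable_continuous_real continuous_on_mult_left continuous_on_mult) auto
    finally show ?thesis by simp
  qed
  then show ?thesis
    unfolding edge_inner_def
    by (simp add: sum_distrib_left sum.swap[of _ B])
qed

section \<open>Green's formula and sums of eigenfunctions\<close>

context metric_graph
begin

text \<open>Elliptic regularity in one dimension: the second derivative equals
  \<open>- s * f\<close> almost everywhere, and \<open>f\<close> is continuous, hence
  \<open>g\<close> is continuously differentiable.\<close>

lemma eigenspace_laplacian_imp_eigenfunction:
  assumes "f \<in> eigenspace (laplacian G) s"
  shows "\<exists>g \<phi>. eigenfunction G s f g \<phi>"
proof -
  from assms obtain g h \<phi> where vanish: "\<forall>z. z \<notin> edge_points G (edges G) \<longrightarrow> f z = 0"
    and H1: "\<forall>e\<in>edges G. H1_deriv (len G e) (\<lambda>x. f (e, x)) (\<lambda>x. g (e, x)) \<and>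
                     H1_deriv (len G e) (\<lambda>x. g (e, x)) (\<lambda>x. h (e, x))"
    and vert: "\<forall>e\<in>edges G. f (e, 0) = \<phi> (tail G e) \<and> f (e, len G e) = \<phi> (head G e)"
    and kirch: "\<forall>v\<in>vertices G.
            (\<Sum>e | e \<in> edges G \<and> tail G e = v. g (e, 0)) +
            (\<Sum>e | e \<in> edges G \<and> head G e = v. - g (e, len G e)) = 0"
    and ae: "AE z in mg_measure G. s * f z = - h z"
    unfolding eigenspace_def laplacian_def mem_Collect_eq by blast
  have df: "((\<lambda>x. f (e, x)) has_real_derivative g (e, x)) (at x within {0..len G e})"
    and cg: "continuous_on {0..len G e} (\<lambda>x. g (e, x))"
    and dg: "((\<lambda>x. g (e, x)) has_real_derivative - s * f (e, x)) (at x within {0..len G e})"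
    if e: "e \<in> edges G" and x: "x \<in> {0..len G e}" for e x
  proof -
    from H1 e have H: "H1_deriv (len G e) (\<lambda>x. f (e, x)) (\<lambda>x. g (e, x))"
      "H1_deriv (len G e) (\<lambda>x. g (e, x)) (\<lambda>x. h (e, x))" by blast+
    show cg: "continuous_on {0..len G e} (\<lambda>x. g (e, x))" by (rule H1_deriv_integral(1)[OF H(2)])
    show "((\<lambda>x. f (e, x)) has_real_derivative g (e, x)) (at x within {0..len G e})"
      by (rule H1_deriv_imp_DERIV[OF H(1) cg _ x]) simp
    have "continuous_on {0..len G e} (\<lambda>x. - s * f (e, x))"
      by (intro continuous_on_mult_left H1_deriv_integral(1)[OF H(1)])
    then show "((\<lambda>x. g (e, x)) has_real_derivative - s * f (e, x)) (at x within {0..len G e})"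
    proof (rule H1_deriv_imp_DERIV[OF H(2) _ _ x])
      show "AE x in lborel. x \<in> {0..len G e} \<longrightarrow> h (e, x) = - s * f (e, x)"
        using AE_mg_measure_edge[OF ae e] by (rule eventually_mono) auto
    qed
  qed
  \<comment> \<open>\<open>cg\<close> was exported under the premise that \<open>x\<close> is a
    point of the edge; 0 discharges it.\<close>
  have "continuous_on {0..len G e} (\<lambda>x. g (e, x))" if "e \<in> edges G" for e
    using cg[OF that, of 0] len_pos[OF that] by simp
  then have "edgewise_C1 G f g \<phi>" using df vert unfolding edgewise_C1_def by blast
  then show ?thesis using vanish dg kirch unfolding eigenfunction_def by blast
qed

lemma eigenfunction_lincomb:
  assumes "\<And>b. b \<in> B \<Longrightarrow> eigenfunction G s (f b) (g b) (\<phi> b)"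
  shows "eigenfunction G s (\<lambda>z. \<Sum>b\<in>B. c b * f b z) (\<lambda>z. \<Sum>b\<in>B. c b * g b z) (\<lambda>v. \<Sum>b\<in>B. c b * \<phi> b v)"
  unfolding eigenfunction_def
proof (intro conjI ballI allI impI)
  show "edgewise_C1 G (\<lambda>z. \<Sum>b\<in>B. c b * f b z) (\<lambda>z. \<Sum>b\<in>B. c b * g b z) (\<lambda>v. \<Sum>b\<in>B. c b * \<phi> b v)"
    using assms unfolding eigenfunction_def by (intro edgewise_C1_lincomb) blast
  show "(\<Sum>b\<in>B. c b * f b z) = 0" if "z \<notin> edge_points G (edges G)" for z
  proof (rule sum.neutral, rule ballI)
    fix b assume "b \<in> B"
    then have "f b z = 0" using assms that unfolding eigenfunction_def by blast
    then show "c b * f b z = 0" by simp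
  qed
  show "((\<lambda>x. \<Sum>b\<in>B. c b * g b (e, x)) has_real_derivative - s * (\<Sum>b\<in>B. c b * f b (e, x)))
      (at x within {0..len G e})" if "e \<in> edges G" "x \<in> {0..len G e}" for e x
  proof -
    have "((\<lambda>x. \<Sum>b\<in>B. c b * g b (e, x)) has_real_derivative (\<Sum>b\<in>B. c b * (- s * f b (e, x))))
      (at x within {0..len G e})"
      using assms that by (intro DERIV_sum DERIV_cmult) (auto simp: eigenfunction_def)
    then show ?thesis by (simp add: sum_distrib_left mult_ac sum_negf)
  qed
  fix v assume v: "v \<in> vertices G"
  let ?T = "{e \<in> edges G. tail G e = v}" and ?H = "{e \<in> edges G. head G e = v}"
  have "(\<Sum>e\<in>?T. \<Sum>b\<in>B. c b * g b (e, 0)) + (\<Sum>e\<in>?H. - (\<Sum>b\<in>B. c b * g b (e, len G e))) =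
      (\<Sum>b\<in>B. c b * ((\<Sum>e\<in>?T. g b (e, 0)) + (\<Sum>e\<in>?H. - g b (e, len G e))))"
    by (simp add: sum.swap[of _ B] sum_distrib_left distrib_left sum.distrib sum_negf right_diff_distrib sum_subtractf)
  also have "\<dots> = 0" using assms v by (intro sum.neutral) (auto simp: eigenfunction_def)
  finally show "(\<Sum>e\<in>?T. \<Sum>b\<in>B. c b * g b (e, 0)) + (\<Sum>e\<in>?H. - (\<Sum>b\<in>B. c b * g b (e, len G e))) = 0" .
qed

text \<open>Here \<open>f'\<close> is a second function, with derivative \<open>g'\<close>. On each
  edge the product \<open>g * f'\<close> has the derivative \<open>g * g' - s * f * f'\<close>. The
  boundary terms are regrouped by vertices: continuity of \<open>f'\<close> makes
  \<open>\<phi>' v\<close> a common factor, and the other factor vanishes by the Kirchhoff condition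
  on \<open>g\<close>.\<close>

lemma green:
  assumes ef: "eigenfunction G s f g \<phi>" and C1: "edgewise_C1 G f' g' \<phi>'"
  shows "edge_inner G g g' = s * edge_inner G f f'"
proof -
  have C1f: "edgewise_C1 G f g \<phi>" using ef by (simp add: eigenfunction_def)
  have edge: "integral {0..len G e} (\<lambda>x. g (e, x) * g' (e, x)) =
      s * integral {0..len G e} (\<lambda>x. f (e, x) * f' (e, x)) +
      (\<phi>' (head G e) * g (e, len G e) - \<phi>' (tail G e) * g (e, 0))" if e: "e \<in> edges G" for e
  proof -
    let ?I = "{0..len G e}"
    have l: "0 \<le> len G e" using len_pos[OF e] by simp
    note cont = edgewise_C1_continuous[OF C1f e] edgewise_C1_continuous[OF C1 e]
    have "((\<lambda>x. g (e, x) * g' (e, x) - s * (f (e, x) * f' (e, x))) has_integral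
        (g (e, len G e) * f' (e, len G e) - g (e, 0) * f' (e, 0))) ?I"
    proof (rule fundamental_theorem_of_calculus[OF l])
      fix x assume x: "x \<in> ?I"
      have d1: "((\<lambda>x. g (e, x)) has_real_derivative - s * f (e, x)) (at x within ?I)"
        using ef e x by (simp add: eigenfunction_def)
      have d2: "((\<lambda>x. f' (e, x)) has_real_derivative g' (e, x)) (at x within ?I)"
        using C1 e x by (simp add: edgewise_C1_def)
      from DERIV_mult[OF d1 d2]
      show "((\<lambda>x. g (e, x) * f' (e, x)) has_vector_derivative g (e, x) * g' (e, x) - s * (f (e, x) * f' (e, x)))
          (at x within ?I)"
        by (simp add: has_real_derivative_iff_has_vector_derivative algebra_simps)
    qed
    moreover have "((\<lambda>x. g (e, x) * g' (e, x) - s * (f (e, x) * f' (e, x))) has_integral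
        (integral ?I (\<lambda>x. g (e, x) * g' (e, x)) - s * integral ?I (\<lambda>x. f (e, x) * f' (e, x)))) ?I"
      using cont by (intro has_integral_diff has_integral_mult_right integrable_integral
        integrable_continuous_real continuous_on_mult)
    ultimately have "integral ?I (\<lambda>x. g (e, x) * g' (e, x)) - s * integral ?I (\<lambda>x. f (e, x) * f' (e, x)) =
        g (e, len G e) * f' (e, len G e) - g (e, 0) * f' (e, 0)"
      using has_integral_unique by blast
    moreover have "f' (e, 0) = \<phi>' (tail G e)" "f' (e, len G e) = \<phi>' (head G e)"
      using C1 e by (auto simp: edgewise_C1_def)
    ultimately show ?thesis by (simp add: algebra_simps)
  qed
  let ?h = "\<lambda>e. \<phi>' (head G e) * g (e, len G e)" and ?t = "\<lambda>e. \<phi>' (tail G e) * g (e, 0)"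
  have fv: "finite (vertices G)" using finite_edges by (simp add: vertices_def)
  have H: "(\<Sum>v\<in>vertices G. \<Sum>e | e \<in> edges G \<and> head G e = v. ?h e) = sum ?h (edges G)"
    using fv finite_edges by (intro sum.group) (auto simp: vertices_def)
  have T: "(\<Sum>v\<in>vertices G. \<Sum>e | e \<in> edges G \<and> tail G e = v. ?t e) = sum ?t (edges G)"
    using fv finite_edges by (intro sum.group) (auto simp: vertices_def)
  have "(\<Sum>e\<in>edges G. ?h e - ?t e) = (\<Sum>v\<in>vertices G.
      (\<Sum>e | e \<in> edges G \<and> head G e = v. ?h e) - (\<Sum>e | e \<in> edges G \<and> tail G e = v. ?t e))"
    by (simp only: sum_subtractf H T)
  also have "\<dots> = (\<Sum>v\<in>vertices G. - \<phi>' v *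
      ((\<Sum>e | e \<in> edges G \<and> tail G e = v. g (e, 0)) + (\<Sum>e | e \<in> edges G \<and> head G e = v. - g (e, len G e))))"
  proof (intro sum.cong refl)
    fix v
    have "(\<Sum>e | e \<in> edges G \<and> head G e = v. ?h e) = \<phi>' v * (\<Sum>e | e \<in> edges G \<and> head G e = v. g (e, len G e))"
      "(\<Sum>e | e \<in> edges G \<and> tail G e = v. ?t e) = \<phi>' v * (\<Sum>e | e \<in> edges G \<and> tail G e = v. g (e, 0))"
      by (auto simp: sum_distrib_left intro!: sum.cong)
    then show "(\<Sum>e | e \<in> edges G \<and> head G e = v. ?h e) - (\<Sum>e | e \<in> edges G \<and> tail G e = v. ?t e) =
      - \<phi>' v * ((\<Sum>e | e \<in> edges G \<and> tail G e = v. g (e, 0)) +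
        (\<Sum>e | e \<in> edges G \<and> head G e = v. - g (e, len G e)))"
      by (simp add: sum_negf algebra_simps)
  qed
  also have "\<dots> = 0" using ef by (intro sum.neutral) (simp add: eigenfunction_def)
  finally have "(\<Sum>e\<in>edges G. ?h e - ?t e) = 0" .
  then show ?thesis
    unfolding edge_inner_def
    by (simp add: edge sum.distrib sum_distrib_left)
qed

text \<open>Green's formula applies with either function as the eigenfunction, and the left side is
  symmetric.\<close>

lemma eigenfunctions_orthogonal:
  assumes "eigenfunction G s f g \<phi>" "eigenfunction G s' f' g' \<phi>'" "s \<noteq> s'"
  shows "edge_inner G f f' = 0"
proof -
  have "edge_inner G g g' = s * edge_inner G f f'"
    using green[OF assms(1)] assms(2) unfolding eigenfunction_def by blast
  moreover have "edge_inner G g' g = s' * edge_inner G f' f"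
    using green[OF assms(2)] assms(1) unfolding eigenfunction_def by blast
  ultimately show ?thesis
    using assms(3) by (simp add: edge_inner_commute[of G g' g] edge_inner_commute[of G f' f])
qed

lemma edge_inner_nonneg:
  assumes "edgewise_C1 G f g \<phi>"
  shows "0 \<le> edge_inner G f f"
  unfolding edge_inner_def
  using edgewise_C1_continuous(1)[OF assms]
  by (intro sum_nonneg integral_nonneg integrable_continuous_real continuous_on_mult) auto

lemma edge_inner_pos:
  assumes C1: "edgewise_C1 G f g \<phi>" and z: "z \<in> edge_points G (edges G)" "f z \<noteq> 0"
  shows "0 < edge_inner G f f"
proof -
  obtain e x where ex: "z = (e, x)" "e \<in> edges G" "x \<in> {0..len G e}"
    using z by (auto simp: edge_points_def)
  have cont: "continuous_on {0..len G e} (\<lambda>x. f (e, x) * f (e, x))" if "e \<in> edges G" for e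
    by (intro continuous_on_mult edgewise_C1_continuous(1)[OF C1 that])
  have nonneg: "0 \<le> integral {0..len G e} (\<lambda>x. f (e, x) * f (e, x))" if "e \<in> edges G" for e
    using cont[OF that] by (intro integral_nonneg integrable_continuous_real) auto
  have "integral {0..len G e} (\<lambda>x. f (e, x) * f (e, x)) \<noteq> 0"
    using integral_eq_0_iff[OF cont[OF ex(2)] len_pos[OF ex(2)]] ex z(2) by auto
  then have "0 < integral {0..len G e} (\<lambda>x. f (e, x) * f (e, x))"
    using nonneg[OF ex(2)] by linarith
  then show ?thesis
    unfolding edge_inner_def using nonneg finite_edges ex(2) by (intro sum_pos2[of _ e]) auto
qed

text \<open>The coefficients of \<open>f\<close> range over pairs of an eigenvalue and a basis vector of its eigenspace;
  that \<open>f\<close> does not vanish follows from orthogonality of the eigenspaces.\<close>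

lemma low_energy_function:
  fixes w :: "'r \<Rightarrow> 'e \<Rightarrow> real"
  assumes i: "1 \<le> i" "i \<le> (\<Sum>s\<in>{s. s \<le> t \<and> is_eigenvalue (laplacian G) s}. multiplicity (laplacian G) s)"
    and R: "finite R" "card R < i"
  shows "\<exists>f g \<phi>. edgewise_C1 G f g \<phi> \<and> 0 < edge_inner G f f \<and> edge_inner G g g \<le> t * edge_inner G f f \<and>
    (\<forall>r\<in>R. (\<Sum>e\<in>edges G. w r e * integral {0..len G e} (\<lambda>x. f (e, x))) = 0)"
proof -
  define S where "S = {s. s \<le> t \<and> is_eigenvalue (laplacian G) s}"
  \<comment> \<open>A sum over an infinite set is 0 by convention, which would contradict
    \<open>1 \<le> i\<close>.\<close>
  have S: "finite S" using i unfolding S_def by (metis not_one_le_zero sum.infinite le_trans)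
  have "\<exists>B. B \<subseteq> eigenspace (laplacian G) s \<and> finite B \<and> funs.independent B \<and>
      card B = multiplicity (laplacian G) s" for s
  proof -
    obtain B where "B \<subseteq> eigenspace (laplacian G) s" "funs.independent B"
      "card B = multiplicity (laplacian G) s"
      using funs.basis_exists unfolding multiplicity_def by metis
    then show ?thesis
      \<comment> \<open>\<open>multiplicity\<close> is \<open>0\<close> for an infinite-dimensional eigenspace\<close>
      by (cases "finite B") (blast, intro exI[of _ "{}"], auto simp: funs.independent_empty)
  qed
  then obtain B where B: "\<And>s. B s \<subseteq> eigenspace (laplacian G) s" "\<And>s. finite (B s)"
    "\<And>s. funs.independent (B s)" "\<And>s. card (B s) = multiplicity (laplacian G) s"
    by metis
  have "\<forall>s. \<forall>f\<in>B s. \<exists>g \<phi>. eigenfunction G s f g \<phi>"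
    using B(1) eigenspace_laplacian_imp_eigenfunction by blast
  then obtain D \<Phi> where D: "\<And>s f. f \<in> B s \<Longrightarrow> eigenfunction G s f (D s f) (\<Phi> s f)"
    by metis
  let ?P = "Sigma S B"
  have "card ?P = (\<Sum>s\<in>S. card (B s))" using S B(2) by (intro card_SigmaI) auto
  then have "card R < card ?P" using i R by (simp add: B(4) S_def)
  moreover have "finite ?P" using S B(2) by auto
  ultimately obtain c where c: "\<exists>b\<in>?P. c b \<noteq> 0"
    "\<forall>r\<in>R. (\<Sum>b\<in>?P. (\<Sum>e\<in>edges G. w r e * integral {0..len G e} (\<lambda>x. snd b (e, x))) * c b) = 0"
    using homogeneous_system_nontrivial[OF R(1), of ?P
      "\<lambda>r b. \<Sum>e\<in>edges G. w r e * integral {0..len G e} (\<lambda>x. snd b (e, x))"] by blast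
  define fs where "fs s = (\<lambda>z. \<Sum>f\<in>B s. c (s, f) * f z)" for s
  define gs where "gs s = (\<lambda>z. \<Sum>f\<in>B s. c (s, f) * D s f z)" for s
  define \<phi>s where "\<phi>s s = (\<lambda>v. \<Sum>f\<in>B s. c (s, f) * \<Phi> s f v)" for s
  have ef: "eigenfunction G s (fs s) (gs s) (\<phi>s s)" for s
    unfolding fs_def gs_def \<phi>s_def by (rule eigenfunction_lincomb) (rule D)
  then have C1s: "edgewise_C1 G (fs s) (gs s) (\<phi>s s)" for s by (simp add: eigenfunction_def)
  note conts = edgewise_C1_continuous[OF C1s]
  \<comment> \<open>The factors 1 give \<open>f\<close>, \<open>g\<close> and \<open>\<phi>\<close>
    the shape that the lemmas on linear combinations expect.\<close>
  define f where "f = (\<lambda>z. \<Sum>s\<in>S. 1 * fs s z)"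
  define g where "g = (\<lambda>z. \<Sum>s\<in>S. 1 * gs s z)"
  define \<phi> where "\<phi> = (\<lambda>z. \<Sum>s\<in>S. 1 * \<phi>s s z)"
  have C1: "edgewise_C1 G f g \<phi>"
    unfolding f_def g_def \<phi>_def by (rule edgewise_C1_lincomb) (rule C1s)
  note cont = edgewise_C1_continuous[OF C1]
  \<comment> \<open>Only the component in the same eigenspace survives, so norm and energy of
    \<open>f\<close> become sums over the eigenvalues in \<open>S\<close>.\<close>
  have inner_s: "edge_inner G (fs s) f = edge_inner G (fs s) (fs s)" if "s \<in> S" for s
  proof -
    have "edge_inner G f (fs s) = (\<Sum>s'\<in>S. 1 * edge_inner G (fs s') (fs s))"
      unfolding f_def using S conts by (intro edge_inner_lincomb_left) auto
    also have "\<dots> = (\<Sum>s'\<in>S. if s' = s then edge_inner G (fs s) (fs s) else 0)"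
      using eigenfunctions_orthogonal[OF ef ef] by (intro sum.cong) auto
    finally show ?thesis using S that by (simp add: edge_inner_commute[of G "fs s" f])
  qed
  have ff: "edge_inner G f f = (\<Sum>s\<in>S. edge_inner G (fs s) (fs s))"
  proof -
    have "edge_inner G f f = (\<Sum>s\<in>S. 1 * edge_inner G (fs s) f)"
      using S conts cont by (subst (1) f_def, intro edge_inner_lincomb_left) auto
    then show ?thesis by (simp add: inner_s)
  qed
  have "edge_inner G g g = (\<Sum>s\<in>S. 1 * edge_inner G (gs s) g)"
    using S conts cont by (subst (1) g_def, intro edge_inner_lincomb_left) auto
  also have "\<dots> = (\<Sum>s\<in>S. s * edge_inner G (fs s) (fs s))"
    using green[OF ef C1] by (simp add: inner_s)
  also have "\<dots> \<le> (\<Sum>s\<in>S. t * edge_inner G (fs s) (fs s))"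
    by (intro sum_mono mult_right_mono edge_inner_nonneg[OF C1s]) (auto simp: S_def)
  finally have energy: "edge_inner G g g \<le> t * edge_inner G f f"
    by (simp add: ff sum_distrib_left)
  \<comment> \<open>One nonzero coefficient makes its component \<open>fs s0\<close> nonzero, by
    independence inside a single eigenspace; the components for different eigenvalues cannot cancel,
    because \<open>ff\<close> adds up their squared norms.\<close>
  obtain s0 f0 where s0: "s0 \<in> S" "f0 \<in> B s0" "c (s0, f0) \<noteq> 0" using c(1) by auto
  then obtain z where z: "fs s0 z \<noteq> 0"
    unfolding fs_def using funs_independent_lincomb_nonzero[OF B(3,2), of f0 s0 "\<lambda>f. c (s0, f)"] by auto
  moreover have "z \<in> edge_points G (edges G)"
    using z ef[of s0] unfolding eigenfunction_def by blast
  ultimately have "0 < edge_inner G (fs s0) (fs s0)" by (intro edge_inner_pos[OF C1s])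
  then have pos: "0 < edge_inner G f f"
    unfolding ff using S s0 edge_inner_nonneg[OF C1s] by (intro sum_pos2[of _ s0]) auto
  have "(\<Sum>e\<in>edges G. w r e * integral {0..len G e} (\<lambda>x. f (e, x))) = 0" if r: "r \<in> R" for r
  proof -
    have Bcont: "continuous_on {0..len G e} (\<lambda>x. b (e, x))" if "b \<in> B s" "e \<in> edges G" for b s e
      using D[OF that(1), unfolded eigenfunction_def, THEN conjunct1] that(2)
      by (rule edgewise_C1_continuous(1))
    have "integral {0..len G e} (\<lambda>x. f (e, x)) =
        (\<Sum>b\<in>?P. c b * integral {0..len G e} (\<lambda>x. snd b (e, x)))" if e: "e \<in> edges G" for e
    proof -
      have "integral {0..len G e} (\<lambda>x. f (e, x)) = integral {0..len G e} (\<lambda>x. \<Sum>b\<in>?P. c b * snd b (e, x))"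
        unfolding f_def fs_def using S B(2) by (simp add: sum.Sigma case_prod_beta)
      also have "\<dots> = (\<Sum>b\<in>?P. integral {0..len G e} (\<lambda>x. c b * snd b (e, x)))"
        using S B(2) Bcont e
        by (intro integral_sum integrable_continuous_real continuous_on_mult_left) auto
      finally show ?thesis by simp
    qed
    then have "(\<Sum>e\<in>edges G. w r e * integral {0..len G e} (\<lambda>x. f (e, x))) =
        (\<Sum>e\<in>edges G. \<Sum>b\<in>?P. w r e * (c b * integral {0..len G e} (\<lambda>x. snd b (e, x))))"
      by (simp add: sum_distrib_left)
    also have "\<dots> = (\<Sum>b\<in>?P. (\<Sum>e\<in>edges G. w r e * integral {0..len G e} (\<lambda>x. snd b (e, x))) * c b)"
      by (subst sum.swap) (simp add: sum_distrib_right sum_distrib_left mult_ac)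
    finally show ?thesis using c(2) r by simp
  qed
  then show ?thesis using C1 pos energy by blast
qed

end

section \<open>The normalized Laplacian\<close>

text \<open>First-order optimality: near \<open>e = 0\<close> the linear term dominates. With
  \<open>e = - b / d\<close>, where \<open>d\<close> is positive and at least \<open>c\<close>, the
  expression is at most \<open>e * b\<close>, that is, minus \<open>b\<^sup>2 / d\<close>.\<close>

lemma nonneg_quadratic_imp_linear_zero:
  fixes b c :: real
  assumes "0 \<le> b" "\<And>e. 0 \<le> 2 * e * b + e\<^sup>2 * c"
  shows "b = 0"
proof -
  define d where "d = \<bar>c\<bar> + 1"
  define e where "e = - b / d"
  have d: "0 < d" "c \<le> d" by (auto simp: d_def)
  have ed: "e * d = - b" using d by (simp add: e_def)
  have "e\<^sup>2 * c \<le> e\<^sup>2 * d" using d by (intro mult_left_mono) auto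
  also have "\<dots> = - (e * b)" by (simp add: power2_eq_square mult.assoc ed)
  finally have "0 \<le> e * b" using assms(2)[of e] by simp
  then have "0 \<le> d * (e * b)" using d(1) by simp
  then have "0 \<le> e * d * b" by (simp only: mult_ac)
  then show ?thesis unfolding ed using assms(1) by (simp add: mult_le_0_iff)
qed

locale weighted_graph =
  fixes V :: "'a set" and \<mu> :: "'a \<Rightarrow> 'a \<Rightarrow> real"
  assumes finite_V: "finite V"
    and weight_sym: "v \<in> V \<Longrightarrow> w \<in> V \<Longrightarrow> \<mu> v w = \<mu> w v"
    and degree_pos: "v \<in> V \<Longrightarrow> 0 < weighted_degree V \<mu> v"
begin

abbreviation deg :: "'a \<Rightarrow> real" where "deg \<equiv> weighted_degree V \<mu>"

abbreviation fs :: "('a \<Rightarrow> real) set" where "fs \<equiv> {f. \<forall>v. v \<notin> V \<longrightarrow> f v = 0}"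

text \<open>The inner product for which the normalized Laplacian is self-adjoint; the degrees cancel
  the factor \<open>1 / deg v\<close>.\<close>

definition inner_deg :: "('a \<Rightarrow> real) \<Rightarrow> ('a \<Rightarrow> real) \<Rightarrow> real" where
  "inner_deg f g = (\<Sum>v\<in>V. deg v * (f v * g v))"

definition lap :: "('a \<Rightarrow> real) \<Rightarrow> 'a \<Rightarrow> real" where
  "lap f v = (if v \<in> V then 1 / deg v * (\<Sum>w\<in>V. \<mu> v w * (f v - f w)) else 0)"

lemma normalized_laplacian_iff_lap: "normalized_laplacian V \<mu> f u \<longleftrightarrow> f \<in> fs \<and> u = lap f"
  by (auto simp: normalized_laplacian_def lap_def fun_eq_iff)

lemma eigenspace_iff: "f \<in> eigenspace (normalized_laplacian V \<mu>) s \<longleftrightarrow> f \<in> fs \<and> (\<forall>v. lap f v = s * f v)"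
  unfolding eigenspace_def mem_Collect_eq normalized_laplacian_iff_lap by (auto simp: fun_eq_iff)

lemma inner_deg_commute: "inner_deg f g = inner_deg g f"
  by (simp add: inner_deg_def mult.commute)

lemma inner_deg_lincomb: "inner_deg (\<lambda>v. a * f v + b * g v) h = a * inner_deg f h + b * inner_deg g h"
  by (simp add: inner_deg_def sum_distrib_left sum.distrib algebra_simps)

lemma inner_deg_sum: "inner_deg (\<lambda>v. \<Sum>b\<in>B. c b * f b v) h = (\<Sum>b\<in>B. c b * inner_deg (f b) h)"
  by (simp add: inner_deg_def sum_distrib_left sum_distrib_right sum.swap[of _ V] mult_ac)

lemma inner_deg_pos: "f \<in> fs \<Longrightarrow> f \<noteq> 0 \<Longrightarrow> 0 < inner_deg f f"
proof -
  assume "f \<in> fs" "f \<noteq> 0"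
  then obtain v where "v \<in> V" "f v \<noteq> 0" by (auto simp: fun_eq_iff)
  then show ?thesis unfolding inner_deg_def using finite_V degree_pos
    by (intro sum_pos2[of _ v] mult_nonneg_nonneg[OF _ zero_le_square] mult_pos_pos[where b = "f v * f v"])
      (auto simp: less_imp_le not_real_square_gt_zero[symmetric] simp del: not_real_square_gt_zero)
qed

lemma inner_lap: "inner_deg (lap f) g = (\<Sum>v\<in>V. \<Sum>w\<in>V. \<mu> v w * (f v - f w) * g v)"
  unfolding inner_deg_def
proof (intro sum.cong refl)
  fix v assume v: "v \<in> V"
  then show "deg v * (lap f v * g v) = (\<Sum>w\<in>V. \<mu> v w * (f v - f w) * g v)"
    using degree_pos[OF v] by (simp add: lap_def sum_distrib_right)
qed

lemma inner_lap_commute: "inner_deg (lap f) g = inner_deg f (lap g)"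
proof -
  have swap: "(\<Sum>v\<in>V. \<Sum>w\<in>V. \<mu> v w * f w * g v) = (\<Sum>v\<in>V. \<Sum>w\<in>V. \<mu> v w * g w * f v)"
    by (subst sum.swap) (intro sum.cong refl, simp add: weight_sym mult_ac)
  have "inner_deg (lap f) g = (\<Sum>v\<in>V. \<Sum>w\<in>V. \<mu> v w * f v * g v) - (\<Sum>v\<in>V. \<Sum>w\<in>V. \<mu> v w * f w * g v)"
    by (simp add: inner_lap sum_subtractf[symmetric] algebra_simps)
  moreover have "inner_deg (lap g) f = (\<Sum>v\<in>V. \<Sum>w\<in>V. \<mu> v w * f v * g v) - (\<Sum>v\<in>V. \<Sum>w\<in>V. \<mu> v w * g w * f v)"
    by (simp add: inner_lap sum_subtractf[symmetric] algebra_simps)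
  ultimately show ?thesis by (simp add: swap inner_deg_commute[of f])
qed

lemma lap_lincomb: "lap (\<lambda>v. a * f v + b * g v) = (\<lambda>v. a * lap f v + b * lap g v)"
proof
  fix v
  have "(\<Sum>w\<in>V. \<mu> v w * (a * f v + b * g v - (a * f w + b * g w))) =
      a * (\<Sum>w\<in>V. \<mu> v w * (f v - f w)) + b * (\<Sum>w\<in>V. \<mu> v w * (g v - g w))"
    by (simp add: sum_distrib_left sum.distrib[symmetric] algebra_simps)
  then show "lap (\<lambda>v. a * f v + b * g v) v = a * lap f v + b * lap g v"
    by (simp add: lap_def distrib_left)
qed

lemma eigenvectors_orthogonal:
  assumes "f \<in> eigenspace (normalized_laplacian V \<mu>) s" "g \<in> eigenspace (normalized_laplacian V \<mu>) t" "s \<noteq> t"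
  shows "inner_deg f g = 0"
proof -
  have "inner_deg (lap f) g = s * inner_deg f g" "inner_deg f (lap g) = t * inner_deg f g"
    using assms(1,2) by (simp_all add: eigenspace_iff inner_deg_def sum_distrib_left mult_ac)
  then show ?thesis using assms(3) inner_lap_commute[of f g] by simp
qed

text \<open>Eigenvectors for different eigenvalues are orthogonal, so more than
  \<open>card V\<close> of them cannot be linearly dependent on \<open>V\<close>, as they would have
  to be. Finiteness also matters because the eigenvalue count would be 0 for an infinite index
  set.\<close>

lemma finite_eigenvalues: "finite {s. is_eigenvalue (normalized_laplacian V \<mu>) s}"
proof (rule ccontr)
  assume "infinite {s. is_eigenvalue (normalized_laplacian V \<mu>) s}"
  then obtain T where T: "finite T" "card T = Suc (card V)" "T \<subseteq> {s. is_eigenvalue (normalized_laplacian V \<mu>) s}"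
    using infinite_arbitrarily_large by metis
  then have "\<forall>s\<in>T. \<exists>f\<in>eigenspace (normalized_laplacian V \<mu>) s. f \<noteq> 0"
    by (auto simp: is_eigenvalue_def)
  then obtain F where F: "\<And>s. s \<in> T \<Longrightarrow> F s \<in> eigenspace (normalized_laplacian V \<mu>) s" "\<And>s. s \<in> T \<Longrightarrow> F s \<noteq> 0"
    by metis
  obtain c where c: "\<exists>s\<in>T. c s \<noteq> 0" "\<forall>v\<in>V. (\<Sum>s\<in>T. F s v * c s) = 0"
    using homogeneous_system_nontrivial[OF finite_V T(1), of "\<lambda>v s. F s v"] T(2) by auto
  from c(1) obtain s0 where s0: "s0 \<in> T" "c s0 \<noteq> 0" by blast
  have "inner_deg (\<lambda>v. \<Sum>s\<in>T. c s * F s v) (F s0) = (\<Sum>s\<in>T. if s = s0 then c s0 * inner_deg (F s0) (F s0) else 0)"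
    unfolding inner_deg_sum using eigenvectors_orthogonal[OF F(1) F(1)] s0 by (intro sum.cong) auto
  also have "\<dots> = c s0 * inner_deg (F s0) (F s0)" using T(1) s0 by simp
  finally have "inner_deg (\<lambda>v. \<Sum>s\<in>T. c s * F s v) (F s0) = c s0 * inner_deg (F s0) (F s0)" .
  moreover have "inner_deg (\<lambda>v. \<Sum>s\<in>T. c s * F s v) (F s0) = 0"
    unfolding inner_deg_def using c(2) by (intro sum.neutral) (simp add: mult.commute)
  moreover have "0 < inner_deg (F s0) (F s0)"
    using F s0(1) by (intro inner_deg_pos) (auto simp: eigenspace_iff)
  ultimately show False using s0 by simp
qed

text \<open>Guarantees that a basis of an eigenspace is finite, so that \<open>multiplicity\<close>
  is its true dimension and not the default cardinality 0 of an infinite set.\<close>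

lemma finite_independent:
  assumes "B \<subseteq> fs" "funs.independent B"
  shows "finite B"
proof (rule ccontr)
  assume "infinite B"
  then obtain T where T: "finite T" "card T = Suc (card V)" "T \<subseteq> B"
    using infinite_arbitrarily_large by metis
  obtain c where c: "\<exists>f\<in>T. c f \<noteq> 0" "\<forall>v\<in>V. (\<Sum>f\<in>T. f v * c f) = 0"
    using homogeneous_system_nontrivial[OF finite_V T(1), of "\<lambda>v f. f v"] T(2) by auto
  have "funs.independent T" using assms(2) T(3) by (rule funs.independent_mono)
  then obtain x where x: "(\<Sum>f\<in>T. c f * f x) \<noteq> 0"
    using c(1) funs_independent_lincomb_nonzero[OF _ T(1)] by blast
  show False
  proof (cases "x \<in> V")
    case True
    then show False using c(2) x by (simp add: mult.commute)
  next
    case False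
    then have "(\<Sum>f\<in>T. c f * f x) = 0" using assms(1) T(3) by (intro sum.neutral) auto
    then show False using x by simp
  qed
qed

text \<open>The function space carries the product topology over an arbitrary index type.
  Coordinates outside \<open>V\<close> are fixed at 0 and those in \<open>V\<close> are bounded, so
  Tychonoff's theorem provides a compact box; the remaining conditions are closed.\<close>

lemma compact_unit_sphere: "compact {f \<in> fs. (\<forall>g\<in>E. inner_deg g f = 0) \<and> inner_deg f f = 1}"
proof -
  \<comment> \<open>A unit vector satisfies \<open>f v * f v \<le> 1 / deg v\<close>, and
    \<open>\<bar>f v\<bar> \<le> f v * f v + 1\<close> yields a bound without square roots.\<close>
  define K where "K v = (if v \<in> V then {- (1 / deg v + 1)..1 / deg v + 1} else {0})" for v
  have "compactin (product_topology (\<lambda>_. euclidean) UNIV) (PiE UNIV K)"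
    unfolding compactin_PiE by (auto simp: K_def)
  then have "compact (PiE UNIV K)" by (simp add: euclidean_product_topology)
  moreover have cont: "continuous_on UNIV (\<lambda>f. inner_deg g f)" "continuous_on UNIV (\<lambda>f. inner_deg f f)" for g
    unfolding inner_deg_def by (intro continuous_intros continuous_on_product_coordinates)+
  have "closed {f. \<forall>g\<in>E. inner_deg g f = 0}"
    unfolding Ball_def by (intro closed_Collect_all closed_Collect_imp closed_Collect_eq cont) auto
  moreover have "closed {f. inner_deg f f = 1}" by (intro closed_Collect_eq cont) auto
  ultimately have "compact (PiE UNIV K \<inter> ({f. \<forall>g\<in>E. inner_deg g f = 0} \<inter> {f. inner_deg f f = 1}))"
    by (intro compact_Int_closed closed_Int)
  moreover have "{f \<in> fs. (\<forall>g\<in>E. inner_deg g f = 0) \<and> inner_deg f f = 1} =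
      PiE UNIV K \<inter> ({f. \<forall>g\<in>E. inner_deg g f = 0} \<inter> {f. inner_deg f f = 1})"
  proof -
    have "f v \<in> {- (1 / deg v + 1)..1 / deg v + 1}" if "inner_deg f f = 1" "v \<in> V" for f v
    proof -
      have "deg v * (f v * f v) \<le> inner_deg f f"
        unfolding inner_deg_def using finite_V that(2) degree_pos
        by (intro member_le_sum) (auto simp: less_imp_le)
      then have "f v * f v \<le> 1 / deg v" using that degree_pos[OF that(2)] by (simp add: field_simps)
      moreover have "(\<bar>f v\<bar> - 1)\<^sup>2 = f v * f v - 2 * \<bar>f v\<bar> + 1"
        by (cases "0 \<le> f v") (simp_all add: power2_eq_square algebra_simps)
      then have "\<bar>f v\<bar> \<le> f v * f v + 1" using zero_le_power2[of "\<bar>f v\<bar> - 1"] by linarith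
      ultimately show ?thesis by auto
    qed
    then show ?thesis by (fastforce simp: K_def PiE_def Pi_def split: if_splits)
  qed
  ultimately show ?thesis by simp
qed

text \<open>The Rayleigh quotient attains its minimum \<open>q\<close> on the orthogonal complement
  \<open>U\<close> of \<open>E\<close>. Because \<open>E\<close> consists of eigenvectors,
  \<open>lap\<close> maps \<open>U\<close> into itself; hence the residual
  \<open>lap m - q * m\<close> of a minimizer \<open>m\<close> is an admissible direction of
  variation, and optimality in that direction forces it to vanish.\<close>

lemma rayleigh_minimizer:
  assumes E: "\<And>g. g \<in> E \<Longrightarrow> \<exists>s. g \<in> eigenspace (normalized_laplacian V \<mu>) s"
    and f: "f \<in> fs" "f \<noteq> 0" "\<forall>g\<in>E. inner_deg g f = 0"
  shows "\<exists>m q. m \<in> eigenspace (normalized_laplacian V \<mu>) q \<and> m \<noteq> 0 \<and> (\<forall>g\<in>E. inner_deg g m = 0) \<and>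
    q * inner_deg f f \<le> inner_deg (lap f) f"
proof -
  define U where "U = {f \<in> fs. \<forall>g\<in>E. inner_deg g f = 0}"
  define S where "S = {f \<in> fs. (\<forall>g\<in>E. inner_deg g f = 0) \<and> inner_deg f f = 1}"
  have U_lin: "(\<lambda>v. a * h v + b * k v) \<in> U" if "h \<in> U" "k \<in> U" for a b h k
    using that inner_deg_lincomb[of a h b k] by (auto simp: U_def inner_deg_commute)
  have normalize: "(\<lambda>v. h v / sqrt (inner_deg h h)) \<in> S"
    "inner_deg (lap h) h = inner_deg h h * inner_deg (lap (\<lambda>v. h v / sqrt (inner_deg h h))) (\<lambda>v. h v / sqrt (inner_deg h h))"
    if h: "h \<in> U" "h \<noteq> 0" for h
  proof -
    have pos: "0 < inner_deg h h" using h by (intro inner_deg_pos) (auto simp: U_def)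
    define r where "r = 1 / sqrt (inner_deg h h)"
    have r2: "r * r * inner_deg h h = 1" using pos by (simp add: r_def field_simps)
    \<comment> \<open>The summand \<open>0 * h v\<close> fits a plain scaling to the two-term
      linearity lemmas.\<close>
    have eq: "(\<lambda>v. h v / sqrt (inner_deg h h)) = (\<lambda>v. r * h v + 0 * h v)" by (simp add: r_def)
    have bil: "inner_deg k (\<lambda>v. r * h v + 0 * h v) = r * inner_deg k h" for k
      using inner_deg_lincomb[of r h 0 h k] by (simp add: inner_deg_commute)
    have "inner_deg (\<lambda>v. r * h v + 0 * h v) (\<lambda>v. r * h v + 0 * h v) = 1"
      unfolding bil inner_deg_lincomb using r2 by simp
    then show "(\<lambda>v. h v / sqrt (inner_deg h h)) \<in> S"
      unfolding eq using U_lin[OF h(1) h(1), of r 0] by (simp add: S_def U_def)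
    have "inner_deg (lap (\<lambda>v. r * h v + 0 * h v)) (\<lambda>v. r * h v + 0 * h v) = r * r * inner_deg (lap h) h"
      unfolding lap_lincomb bil inner_deg_lincomb by simp
    then show "inner_deg (lap h) h = inner_deg h h * inner_deg (lap (\<lambda>v. h v / sqrt (inner_deg h h))) (\<lambda>v. h v / sqrt (inner_deg h h))"
      unfolding eq using r2 by (simp add: mult_ac)
  qed
  have fU: "f \<in> U" using f by (simp add: U_def)
  have "S \<noteq> {}" using normalize(1)[OF fU f(2)] by blast
  moreover have "continuous_on S (\<lambda>f. inner_deg (lap f) f)"
    unfolding inner_lap by (intro continuous_intros continuous_on_subset[OF continuous_on_product_coordinates]) auto
  ultimately obtain m where m: "m \<in> S" "\<And>h. h \<in> S \<Longrightarrow> inner_deg (lap m) m \<le> inner_deg (lap h) h"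
    using continuous_attains_inf[of S "\<lambda>f. inner_deg (lap f) f"] compact_unit_sphere unfolding S_def by blast
  define q where "q = inner_deg (lap m) m"
  have mU: "m \<in> U" and m1: "inner_deg m m = 1" using m(1) by (auto simp: S_def U_def)
  have q: "q * inner_deg h h \<le> inner_deg (lap h) h" if h: "h \<in> U" for h
  proof (cases "h = 0")
    case True
    then show ?thesis by (simp add: inner_deg_def)
  next
    case False
    have "0 < inner_deg h h" using h False by (intro inner_deg_pos) (auto simp: U_def)
    then show ?thesis
      using m(2)[OF normalize(1)[OF h False]] unfolding normalize(2)[OF h False] q_def
      by (simp add: mult.commute)
  qed
  define r where "r = (\<lambda>v. 1 * lap m v + (- q) * m v)"
  have "lap m \<in> U"
  proof -
    have "inner_deg g (lap m) = 0" if g: "g \<in> E" for g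
    proof -
      obtain s where "g \<in> eigenspace (normalized_laplacian V \<mu>) s" using E[OF g] by blast
      then have "inner_deg (lap g) m = s * inner_deg g m"
        by (simp add: eigenspace_iff inner_deg_def sum_distrib_left mult_ac)
      then show ?thesis using mU g by (simp add: inner_lap_commute U_def)
    qed
    then show ?thesis by (simp add: U_def lap_def)
  qed
  then have rU: "r \<in> U" unfolding r_def using mU by (rule U_lin)
  have r0: "inner_deg r r = 0"
  proof -
    let ?b = "inner_deg r r" and ?c = "inner_deg (lap r) r - q * inner_deg r r"
    have b: "0 \<le> ?b" by (simp add: inner_deg_def sum_nonneg degree_pos less_imp_le)
    have lmr: "inner_deg (lap m) r - q * inner_deg m r = ?b"
      by (subst (3) r_def) (simp only: inner_deg_lincomb)
    \<comment> \<open>The inequality \<open>q\<close> for \<open>m + e * r\<close>. The constant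
      terms cancel as \<open>m\<close> attains the minimum, and by \<open>lmr\<close> the linear
      coefficient is twice the squared norm of the residual.\<close>
    have quad: "0 \<le> 2 * e * ?b + e\<^sup>2 * ?c" for e
    proof -
      let ?h = "\<lambda>v. 1 * m v + e * r v"
      have bil: "inner_deg k ?h = inner_deg k m + e * inner_deg k r" for k
        using inner_deg_lincomb[of 1 m e r k] by (simp add: inner_deg_commute)
      have "inner_deg ?h ?h = 1 + 2 * e * inner_deg m r + e\<^sup>2 * inner_deg r r"
        unfolding bil inner_deg_lincomb
        by (simp add: m1 inner_deg_commute[of r m] power2_eq_square algebra_simps)
      moreover have "inner_deg (lap ?h) ?h = q + 2 * e * inner_deg (lap m) r + e\<^sup>2 * inner_deg (lap r) r"
        unfolding lap_lincomb bil inner_deg_lincomb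
        by (simp add: q_def inner_lap_commute[of r m] inner_deg_commute[of r] power2_eq_square algebra_simps)
      ultimately have "q * (1 + 2 * e * inner_deg m r + e\<^sup>2 * inner_deg r r)
          \<le> q + 2 * e * inner_deg (lap m) r + e\<^sup>2 * inner_deg (lap r) r"
        using q[OF U_lin[OF mU rU, of 1 e]] by simp
      then have "0 \<le> 2 * e * (inner_deg (lap m) r - q * inner_deg m r) + e\<^sup>2 * ?c"
        by (simp add: algebra_simps)
      then show ?thesis unfolding lmr .
    qed
    show ?thesis using b quad by (rule nonneg_quadratic_imp_linear_zero)
  qed
  have "r = 0" using inner_deg_pos[of r] rU r0 by (auto simp: U_def)
  then have "m \<in> eigenspace (normalized_laplacian V \<mu>) q"
    using mU by (auto simp: eigenspace_iff U_def r_def fun_eq_iff)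
  moreover have "m \<noteq> 0" using m1 by (auto simp: inner_deg_def)
  ultimately show ?thesis using mU q[OF fU] by (auto simp: U_def)
qed

text \<open>\<open>E\<close> collects bases of all eigenspaces with eigenvalue at most
  \<open>a\<close>. A minimizer on its complement is an eigenvector for some \<open>q\<close>; if
  \<open>q \<le> a\<close>, it would lie in the span of \<open>E\<close> and be orthogonal to
  itself. So \<open>a < q\<close>, which gives the strict inequality.\<close>

lemma low_modes:
  "\<exists>E. finite E \<and>
     card E \<le> (\<Sum>s\<in>{s. s \<le> a \<and> is_eigenvalue (normalized_laplacian V \<mu>) s}. multiplicity (normalized_laplacian V \<mu>) s) \<and>
     (\<forall>f\<in>fs. f \<noteq> 0 \<longrightarrow> (\<forall>g\<in>E. inner_deg g f = 0) \<longrightarrow> a * inner_deg f f < inner_deg (lap f) f)"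
proof -
  let ?T = "normalized_laplacian V \<mu>"
  define S where "S = {s. s \<le> a \<and> is_eigenvalue ?T s}"
  have S: "finite S" unfolding S_def using finite_eigenvalues by (rule rev_finite_subset) auto
  have "\<exists>B. B \<subseteq> eigenspace ?T s \<and> finite B \<and> eigenspace ?T s \<subseteq> funs.span B \<and> card B = multiplicity ?T s" for s
  proof -
    obtain B where "B \<subseteq> eigenspace ?T s" "funs.independent B" "eigenspace ?T s \<subseteq> funs.span B"
      "card B = multiplicity ?T s"
      using funs.basis_exists unfolding multiplicity_def by metis
    moreover from this have "finite B" by (intro finite_independent) (auto simp: eigenspace_iff)
    ultimately show ?thesis by blast
  qed
  then obtain B where B: "\<And>s. B s \<subseteq> eigenspace ?T s" "\<And>s. finite (B s)"
    "\<And>s. eigenspace ?T s \<subseteq> funs.span (B s)" "\<And>s. card (B s) = multiplicity ?T s"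
    by metis
  define E where "E = (\<Union>s\<in>S. B s)"
  have "card E \<le> (\<Sum>s\<in>S. multiplicity ?T s)"
    unfolding E_def using card_UN_le[OF S, of B] by (simp add: B(4))
  moreover have "finite E" unfolding E_def using S B(2) by blast
  moreover have "a * inner_deg f f < inner_deg (lap f) f"
    if f: "f \<in> fs" "f \<noteq> 0" "\<forall>g\<in>E. inner_deg g f = 0" for f
  proof -
    have "\<exists>s. g \<in> eigenspace ?T s" if "g \<in> E" for g using that B(1) by (auto simp: E_def)
    from rayleigh_minimizer[OF this f]
    obtain m q where m: "m \<in> eigenspace ?T q" "m \<noteq> 0" "\<forall>g\<in>E. inner_deg g m = 0"
      and q: "q * inner_deg f f \<le> inner_deg (lap f) f" by blast
    have "a < q"
    proof (rule ccontr)
      assume "\<not> a < q"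
      then have "q \<in> S" using m by (auto simp: S_def is_eigenvalue_def)
      then have orth: "inner_deg g m = 0" if "g \<in> B q" for g using m(3) that by (auto simp: E_def)
      have "inner_deg h m = 0" if "h \<in> funs.span (B q)" for h
        using that
      proof (induction rule: funs.span_induct_alt)
        case base
        then show ?case by (simp add: inner_deg_def)
      next
        case (step c x y)
        then show ?case using orth inner_deg_lincomb[of c x 1 y m] by (simp add: plus_fun_def)
      qed
      then have "inner_deg m m = 0" using m(1) B(3) by blast
      then show False using inner_deg_pos[of m] m by (simp add: eigenspace_iff)
    qed
    then have "a * inner_deg f f < q * inner_deg f f"
      using inner_deg_pos[OF f(1,2)] by (intro mult_strict_right_mono)
    then show ?thesis using q by linarith
  qed
  ultimately show ?thesis unfolding S_def by blast
qed

end

section \<open>Cycle double covers\<close>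

lemma edgewise_C1_profile:
  assumes "edgewise_C1 G f g \<phi>" "e \<in> edges G"
  shows "profile (len G e) (\<phi> (tail G e)) (\<phi> (head G e))
    (integral {0..len G e} (\<lambda>x. f (e, x))) (integral {0..len G e} (\<lambda>x. f (e, x) * f (e, x)))
    (integral {0..len G e} (\<lambda>x. g (e, x) * g (e, x)))"
proof -
  note cont = edgewise_C1_continuous[OF assms]
  have "((\<lambda>x. f (e, x)) has_real_derivative g (e, x)) (at x)" if "x \<in> {0<..<len G e}" for x
  proof -
    have "((\<lambda>x. f (e, x)) has_real_derivative g (e, x)) (at x within {0..len G e})"
      using assms that by (auto simp: edgewise_C1_def)
    then show ?thesis using that by (simp add: at_within_Icc_at)
  qed
  moreover have "f (e, 0) = \<phi> (tail G e)" "f (e, len G e) = \<phi> (head G e)"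
    using assms by (auto simp: edgewise_C1_def)
  ultimately show ?thesis
    unfolding profile_def power2_eq_square
    by (intro exI[of _ "\<lambda>x. f (e, x)"] exI[of _ "\<lambda>x. g (e, x)"] exI[of _ "{}"] conjI
        integrable_integral integrable_continuous_real continuous_on_mult cont) simp_all
qed

context metric_graph
begin

text \<open>The profiles of the edges are concatenated in cyclic order, and the closed result has
  equal boundary values. The edge set \<open>A\<close> is produced before \<open>f\<close> is
  chosen, since one and the same set has to serve all functions and the covering condition.\<close>

lemma cycle_within_wirtinger:
  assumes "cycle_within G C"
  obtains A where "A \<subseteq> edges G" "A \<noteq> {}" "C = edge_points G A"
    "\<And>f g \<phi>. edgewise_C1 G f g \<phi> \<Longrightarrow>
      (2 * pi / (\<Sum>e\<in>A. len G e))\<^sup>2 *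
        ((\<Sum>e\<in>A. integral {0..len G e} (\<lambda>x. f (e, x) * f (e, x))) -
          (\<Sum>e\<in>A. integral {0..len G e} (\<lambda>x. f (e, x)))\<^sup>2 / (\<Sum>e\<in>A. len G e))
      \<le> (\<Sum>e\<in>A. integral {0..len G e} (\<lambda>x. g (e, x) * g (e, x)))"
proof -
  from assms obtain n vs es where n: "2 \<le> n" and inj: "inj_on es {..<n}" and sub: "es ` {..<n} \<subseteq> edges G"
    and ends: "\<forall>m<n. {tail G (es m), head G (es m)} = {vs m, vs (Suc m mod n)}"
    and C: "C = edge_points G (es ` {..<n})"
    unfolding cycle_within_def by blast
  show thesis
  proof (rule that[OF sub _ C])
    show "es ` {..<n} \<noteq> {}" using n by (auto simp: lessThan_empty_iff)
    fix f g \<phi> assume C1: "edgewise_C1 G f g \<phi>"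
    let ?I = "\<lambda>e. integral {0..len G e} (\<lambda>x. f (e, x))"
    let ?K = "\<lambda>e. integral {0..len G e} (\<lambda>x. f (e, x) * f (e, x))"
    let ?D = "\<lambda>e. integral {0..len G e} (\<lambda>x. g (e, x) * g (e, x))"
    have l: "0 \<le> len G (es m)" if "m < n" for m using len_pos[of "es m"] sub that by auto
    \<comment> \<open>The reduction modulo \<open>n\<close> closes the cycle: for
      \<open>p = n\<close> the right end is \<open>vs 0\<close> again.\<close>
    have "profile (\<Sum>m<p. len G (es m)) (\<phi> (vs 0)) (\<phi> (vs (p mod n)))
        (\<Sum>m<p. ?I (es m)) (\<Sum>m<p. ?K (es m)) (\<Sum>m<p. ?D (es m))" if "p \<le> n" for p
      using that
    proof (induction p)
      case 0
      show ?case unfolding profile_def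
        by (intro exI[of _ "\<lambda>_. \<phi> (vs 0)"] exI[of _ "\<lambda>_. 0"] exI[of _ "{}"]) (simp add: has_integral_refl)
    next
      case (Suc p)
      then have p: "p < n" "p mod n = p" by auto
      then have e: "es p \<in> edges G" using sub by auto
      have "tail G (es p) = vs p \<and> head G (es p) = vs (Suc p mod n) \<or>
          tail G (es p) = vs (Suc p mod n) \<and> head G (es p) = vs p"
        using ends p(1) by (metis doubleton_eq_iff)
      then have "profile (len G (es p)) (\<phi> (vs p)) (\<phi> (vs (Suc p mod n))) (?I (es p)) (?K (es p)) (?D (es p))"
      proof (elim disjE conjE)
        assume "tail G (es p) = vs p" "head G (es p) = vs (Suc p mod n)"
        then show ?thesis using edgewise_C1_profile[OF C1 e] by simp
      next
        assume "tail G (es p) = vs (Suc p mod n)" "head G (es p) = vs p"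
        then show ?thesis using profile_rev[OF edgewise_C1_profile[OF C1 e] l[OF p(1)]] by simp
      qed
      moreover have "profile (\<Sum>m<p. len G (es m)) (\<phi> (vs 0)) (\<phi> (vs p))
          (\<Sum>m<p. ?I (es m)) (\<Sum>m<p. ?K (es m)) (\<Sum>m<p. ?D (es m))"
        using Suc p by simp
      moreover have "0 \<le> (\<Sum>m<p. len G (es m))" using l p(1) by (intro sum_nonneg) auto
      ultimately show ?case unfolding sum.lessThan_Suc using l[OF p(1)] by (intro profile_append)
    qed
    \<comment> \<open>Injectivity of \<open>es\<close> turns sums over positions into sums over
      edges.\<close>
    from this[of n] have "profile (sum (len G) (es ` {..<n})) (\<phi> (vs 0)) (\<phi> (vs 0))
        (sum ?I (es ` {..<n})) (sum ?K (es ` {..<n})) (sum ?D (es ` {..<n}))"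
      by (simp add: sum.reindex[OF inj])
    moreover have "0 < sum (len G) (es ` {..<n})"
      using n sub len_pos by (intro sum_pos) (auto simp: lessThan_empty_iff)
    ultimately show "(2 * pi / sum (len G) (es ` {..<n}))\<^sup>2 *
        (sum ?K (es ` {..<n}) - (sum ?I (es ` {..<n}))\<^sup>2 / sum (len G) (es ` {..<n})) \<le> sum ?D (es ` {..<n})"
      by (rule profile_wirtinger)
  qed
qed

end

text \<open>Otherwise the simplifier rewrites \<open>{1..k}\<close> to \<open>{Suc 0..k}\<close>.\<close>
declare One_nat_def [simp del]

section \<open>The dual graph and the overlaps of the cycles\<close>

text \<open>The combinatorial content of a cycle double cover. The cyclic order of the edges is
  forgotten; it enters later only through the Wirtinger inequality for each
  \<open>A j\<close>.\<close>

locale edge_double_cover = metric_graph G for G :: "('v, 'e) mgraph" +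
  fixes k :: nat and A :: "nat \<Rightarrow> 'e set"
  assumes cover_edges: "j \<in> {1..k} \<Longrightarrow> A j \<subseteq> edges G"
    and cover_nonempty: "j \<in> {1..k} \<Longrightarrow> A j \<noteq> {}"
    and cover_twice: "e \<in> edges G \<Longrightarrow> card {j \<in> {1..k}. e \<in> A j} = 2"
begin

abbreviation L :: "nat \<Rightarrow> real" where "L j \<equiv> (\<Sum>e\<in>A j. len G e)"

definition W :: "nat \<Rightarrow> nat \<Rightarrow> real" where
  "W i j = dual_weight G (\<lambda>j. edge_points G (A j)) i j"

lemma L_pos: "j \<in> {1..k} \<Longrightarrow> 0 < L j"
  using cover_edges[of j] cover_nonempty[of j] len_pos finite_edges
  by (intro sum_pos) (auto intro: finite_subset)

lemma sum_member: "j \<in> {1..k} \<Longrightarrow> (\<Sum>e\<in>A j. h e) = (\<Sum>e\<in>edges G. of_bool (e \<in> A j) * h e)"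
  for h :: "'e \<Rightarrow> real"
  using cover_edges[of j] finite_edges
  by (intro sum.mono_neutral_cong_left) auto

lemma sum_cover: "e \<in> edges G \<Longrightarrow> (\<Sum>j\<in>{1..k}. of_bool (e \<in> A j)) = (2 :: real)"
proof -
  assume "e \<in> edges G"
  have "(\<Sum>j\<in>{1..k}. of_bool (e \<in> A j)) = (\<Sum>j\<in>{j \<in> {1..k}. e \<in> A j}. (1 :: real))"
    by (intro sum.mono_neutral_cong_right) auto
  then show ?thesis using cover_twice[OF \<open>e \<in> edges G\<close>] by simp
qed

lemma sum_sum_cover: "(\<Sum>j\<in>{1..k}. \<Sum>e\<in>A j. h e) = 2 * (\<Sum>e\<in>edges G. h e)" for h :: "'e \<Rightarrow> real"
proof -
  have "(\<Sum>j\<in>{1..k}. \<Sum>e\<in>A j. h e) = (\<Sum>j\<in>{1..k}. \<Sum>e\<in>edges G. of_bool (e \<in> A j) * h e)"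
    by (intro sum.cong refl sum_member)
  also have "\<dots> = (\<Sum>e\<in>edges G. (\<Sum>j\<in>{1..k}. of_bool (e \<in> A j)) * h e)"
    by (subst sum.swap) (simp only: sum_distrib_right)
  also have "\<dots> = (\<Sum>e\<in>edges G. 2 * h e)"
    by (intro sum.cong refl) (simp only: sum_cover)
  finally show ?thesis by (simp add: sum_distrib_left)
qed

text \<open>The Gram matrix of the indicator functions of the cycles: the dual weights off the
  diagonal, the cycle lengths on it.\<close>

definition overlap :: "nat \<Rightarrow> nat \<Rightarrow> real" where
  "overlap i j = (\<Sum>e\<in>edges G. of_bool (e \<in> A i) * of_bool (e \<in> A j) * len G e)"

lemma W_eq_overlap: "i \<in> {1..k} \<Longrightarrow> j \<in> {1..k} \<Longrightarrow> W i j = (if i = j then 0 else overlap i j)"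
proof -
  assume ij: "i \<in> {1..k}" "j \<in> {1..k}"
  have "edge_points G (A i) \<inter> edge_points G (A j) = edge_points G (A i \<inter> A j)"
    by (auto simp: edge_points_def)
  moreover have "mg_length G (edge_points G (A i \<inter> A j)) = (\<Sum>e\<in>A i \<inter> A j. len G e)"
    using cover_edges[OF ij(1)] by (intro mg_length_edge_points) auto
  moreover have "\<dots> = overlap i j"
    unfolding overlap_def using cover_edges[OF ij(1)] finite_edges
    by (intro sum.mono_neutral_cong_left) auto
  ultimately show ?thesis by (simp add: W_def dual_weight_def)
qed

lemma sum_overlap: "i \<in> {1..k} \<Longrightarrow> (\<Sum>j\<in>{1..k}. overlap i j) = 2 * L i"
proof -
  assume i: "i \<in> {1..k}"
  have "(\<Sum>j\<in>{1..k}. overlap i j) = (\<Sum>e\<in>edges G. (\<Sum>j\<in>{1..k}. of_bool (e \<in> A j)) * (of_bool (e \<in> A i) * len G e))"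
    unfolding overlap_def by (subst sum.swap) (simp only: sum_distrib_right, simp only: mult_ac)
  also have "\<dots> = (\<Sum>e\<in>edges G. 2 * (of_bool (e \<in> A i) * len G e))"
    by (intro sum.cong refl) (simp only: sum_cover)
  also have "\<dots> = 2 * L i" unfolding sum_member[OF i] sum_distrib_left ..
  finally show ?thesis .
qed

text \<open>Each edge of cycle \<open>i\<close> lies in exactly one further member of the family. In
  terms of row sums: the full overlaps add up to \<open>2 * L i\<close>, and the diagonal accounts
  for one \<open>L i\<close>.\<close>

lemma degree_W: "i \<in> {1..k} \<Longrightarrow> weighted_degree {1..k} W i = L i"
proof -
  assume i: "i \<in> {1..k}"
  have "overlap i i = L i" unfolding overlap_def sum_member[OF i] by (intro sum.cong) auto
  moreover have "(\<Sum>j\<in>{1..k}. overlap i j) = overlap i i + (\<Sum>j\<in>{1..k} - {i}. overlap i j)"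
    using i by (intro sum.remove) auto
  moreover have "(\<Sum>j\<in>{1..k}. W i j) = W i i + (\<Sum>j\<in>{1..k} - {i}. W i j)"
    using i by (intro sum.remove) auto
  moreover have "(\<Sum>j\<in>{1..k} - {i}. W i j) = (\<Sum>j\<in>{1..k} - {i}. overlap i j)"
    using i by (intro sum.cong) (auto simp: W_eq_overlap)
  ultimately show ?thesis using sum_overlap[OF i] i by (simp add: weighted_degree_def W_eq_overlap)
qed

sublocale dual: weighted_graph "{1..k}" W
proof
  show "W v w = W w v" if "v \<in> {1..k}" "w \<in> {1..k}" for v w
    by (simp add: W_def dual_weight_def Int_commute)
  show "0 < weighted_degree {1..k} W v" if "v \<in> {1..k}" for v
    using L_pos[OF that] degree_W[OF that] by simp
qed simp

text \<open>The adjoint of the map that sends a function on the metric graph to its means over the cycles.\<close>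

definition edge_sum :: "(nat \<Rightarrow> real) \<Rightarrow> 'e \<Rightarrow> real" where
  "edge_sum m e = (\<Sum>j\<in>{1..k}. of_bool (e \<in> A j) * m j)"

lemma inner_deg_eq: "dual.inner_deg m m' = (\<Sum>j\<in>{1..k}. L j * (m j * m' j))"
  unfolding dual.inner_deg_def by (intro sum.cong refl) (simp only: degree_W)

text \<open>The identity P P* = 2 - Lambda as quadratic forms. Expanding \<open>m i - m j\<close>,
  the row sums of \<open>overlap\<close> produce the first term; the mixed terms are the squared
  norm of the function with value \<open>edge_sum m e\<close> on edge \<open>e\<close>.\<close>

lemma inner_lap_eq: "dual.inner_deg (dual.lap m) m =
    2 * dual.inner_deg m m - (\<Sum>e\<in>edges G. len G e * (edge_sum m e)\<^sup>2)"
proof -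
  \<comment> \<open>\<open>W\<close> and \<open>overlap\<close> differ only on the diagonal, where
    \<open>m i - m j\<close> vanishes.\<close>
  have "dual.inner_deg (dual.lap m) m = (\<Sum>i\<in>{1..k}. \<Sum>j\<in>{1..k}. overlap i j * (m i - m j) * m i)"
    unfolding dual.inner_lap by (intro sum.cong refl) (simp add: W_eq_overlap)
  also have "\<dots> = (\<Sum>i\<in>{1..k}. (\<Sum>j\<in>{1..k}. overlap i j) * (m i * m i)) -
      (\<Sum>i\<in>{1..k}. \<Sum>j\<in>{1..k}. overlap i j * (m i * m j))"
    by (simp only: sum_distrib_right sum_subtractf[symmetric]) (intro sum.cong refl, simp add: algebra_simps)
  also have "(\<Sum>i\<in>{1..k}. (\<Sum>j\<in>{1..k}. overlap i j) * (m i * m i)) = 2 * dual.inner_deg m m"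
    unfolding inner_deg_eq sum_distrib_left by (intro sum.cong refl) (simp only: sum_overlap mult.assoc)
  also have "(\<Sum>i\<in>{1..k}. \<Sum>j\<in>{1..k}. overlap i j * (m i * m j)) =
      (\<Sum>i\<in>{1..k}. \<Sum>e\<in>edges G. \<Sum>j\<in>{1..k}. len G e * ((of_bool (e \<in> A i) * m i) * (of_bool (e \<in> A j) * m j)))"
    unfolding overlap_def sum_distrib_right
    by (intro sum.cong refl, subst sum.swap, intro sum.cong refl) (simp only: mult_ac)
  also have "\<dots> = (\<Sum>e\<in>edges G. len G e * (edge_sum m e)\<^sup>2)"
    by (subst sum.swap) (intro sum.cong refl, simp only: edge_sum_def power2_eq_square sum_product,
      simp only: sum_distrib_left)
  finally show ?thesis .
qed

text \<open>A nonzero vector orthogonal to fewer than \<open>k\<close> vectors exists, and the quadratic form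
  of the normalized Laplacian is at most \<open>2 * inner_deg m m\<close>.\<close>

lemma low_mode_lt_2:
  assumes R: "finite R" "card R < k"
    and a: "\<And>f. f \<in> dual.fs \<Longrightarrow> f \<noteq> 0 \<Longrightarrow> (\<forall>g\<in>R. dual.inner_deg g f = 0) \<Longrightarrow>
      a * dual.inner_deg f f < dual.inner_deg (dual.lap f) f"
  shows "a < 2"
proof -
  obtain c where c: "\<exists>j\<in>{1..k}. c j \<noteq> 0" "\<forall>g\<in>R. (\<Sum>j\<in>{1..k}. (L j * g j) * c j) = 0"
    using homogeneous_system_nontrivial[OF R(1), of "{1..k}" "\<lambda>g j. L j * g j"] R(2) by auto
  define m where "m j = (if j \<in> {1..k} then c j else 0)" for j
  have "m \<in> dual.fs" by (simp add: m_def)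
  moreover have "m \<noteq> 0" using c(1) by (auto simp: m_def fun_eq_iff)
  moreover have "\<forall>g\<in>R. dual.inner_deg g m = 0"
    using c(2) by (simp add: inner_deg_eq m_def mult.assoc)
  ultimately have "a * dual.inner_deg m m < dual.inner_deg (dual.lap m) m" "0 < dual.inner_deg m m"
    using a dual.inner_deg_pos by blast+
  moreover have "0 \<le> (\<Sum>e\<in>edges G. len G e * (edge_sum m e)\<^sup>2)"
    using len_pos by (intro sum_nonneg mult_nonneg_nonneg) (auto simp: less_imp_le)
  ultimately have "a * dual.inner_deg m m < 2 * dual.inner_deg m m"
    unfolding inner_lap_eq by linarith
  then show ?thesis using \<open>0 < dual.inner_deg m m\<close> by simp
qed

section \<open>From the cycle means to the eigenvalue bound\<close>

text \<open>Let M be the edgewise constant function given by \<open>edge_sum m\<close>, and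
  \<open>b = 2 - a\<close>. Adjointness gives \<open>s\<close> as the inner product of
  \<open>f\<close> and M, and the dual graph gives \<open>Q\<close>, i.e. that the squared norm of M
  is at most \<open>b * s\<close>. Integrating the square of \<open>b * f - M\<close> then yields
  \<open>b * s \<le> b\<^sup>2 * edge_inner G f f\<close>, and \<open>b > 0\<close> can be
  cancelled.\<close>

lemma mean_energy_bound:
  assumes C1: "edgewise_C1 G f g \<phi>" and a: "a < 2"
    and low: "m \<noteq> 0 \<Longrightarrow> a * dual.inner_deg m m < dual.inner_deg (dual.lap m) m"
    and m: "\<And>j. j \<in> {1..k} \<Longrightarrow> L j * m j = (\<Sum>e\<in>A j. integral {0..len G e} (\<lambda>x. f (e, x)))"
  shows "dual.inner_deg m m \<le> (2 - a) * edge_inner G f f"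
proof -
  let ?I = "\<lambda>e. integral {0..len G e} (\<lambda>x. f (e, x))"
  let ?K = "\<lambda>e. integral {0..len G e} (\<lambda>x. f (e, x) * f (e, x))"
  define b where "b = 2 - a"
  define s where "s = dual.inner_deg m m"
  have b: "0 < b" using a by (simp add: b_def)
  have "a * s \<le> dual.inner_deg (dual.lap m) m"
  proof (cases "m = 0")
    case True
    then show ?thesis by (simp add: s_def inner_deg_eq dual.inner_lap)
  qed (use low in \<open>simp add: s_def less_imp_le\<close>)
  then have Q: "(\<Sum>e\<in>edges G. len G e * (edge_sum m e)\<^sup>2) \<le> b * s"
    by (simp add: inner_lap_eq s_def b_def algebra_simps)
  have "s = (\<Sum>j\<in>{1..k}. m j * (L j * m j))" by (simp add: s_def inner_deg_eq mult_ac)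
  also have "\<dots> = (\<Sum>j\<in>{1..k}. m j * (\<Sum>e\<in>edges G. of_bool (e \<in> A j) * ?I e))"
    by (intro sum.cong refl) (simp only: m, simp only: sum_member)
  also have "\<dots> = (\<Sum>j\<in>{1..k}. \<Sum>e\<in>edges G. ?I e * (of_bool (e \<in> A j) * m j))"
    unfolding sum_distrib_left by (simp only: mult_ac)
  also have "\<dots> = (\<Sum>e\<in>edges G. ?I e * edge_sum m e)"
    unfolding edge_sum_def sum_distrib_left by (rule sum.swap)
  finally have s: "s = (\<Sum>e\<in>edges G. ?I e * edge_sum m e)" .
  have "0 \<le> b\<^sup>2 * ?K e - 2 * b * (?I e * edge_sum m e) + len G e * (edge_sum m e)\<^sup>2" if e: "e \<in> edges G" for e
  proof -
    let ?M = "edge_sum m e"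
    note cont = edgewise_C1_continuous(1)[OF C1 e]
    have "((\<lambda>x. b\<^sup>2 * (f (e, x) * f (e, x)) - 2 * b * ?M * f (e, x) + ?M\<^sup>2) has_integral
        (b\<^sup>2 * ?K e - 2 * b * ?M * ?I e + len G e * ?M\<^sup>2)) {0..len G e}"
      using len_pos[OF e] cont has_integral_const_real[of "?M\<^sup>2" 0 "len G e"]
      by (intro has_integral_add has_integral_diff has_integral_mult_right integrable_integral
        integrable_continuous_real continuous_on_mult) auto
    moreover have "b\<^sup>2 * (f (e, x) * f (e, x)) - 2 * b * ?M * f (e, x) + ?M\<^sup>2 = (b * f (e, x) - ?M)\<^sup>2" for x
      by (simp add: power2_eq_square algebra_simps)
    ultimately have "((\<lambda>x. (b * f (e, x) - ?M)\<^sup>2) has_integral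
        (b\<^sup>2 * ?K e - 2 * b * ?M * ?I e + len G e * ?M\<^sup>2)) {0..len G e}"
      by (simp only:)
    then have "0 \<le> b\<^sup>2 * ?K e - 2 * b * ?M * ?I e + len G e * ?M\<^sup>2"
      by (rule has_integral_nonneg) simp
    then show ?thesis by (simp only: mult_ac)
  qed
  then have "0 \<le> (\<Sum>e\<in>edges G. b\<^sup>2 * ?K e - 2 * b * (?I e * edge_sum m e) + len G e * (edge_sum m e)\<^sup>2)"
    by (rule sum_nonneg)
  also have "\<dots> = b\<^sup>2 * edge_inner G f f - 2 * b * s + (\<Sum>e\<in>edges G. len G e * (edge_sum m e)\<^sup>2)"
    unfolding s edge_inner_def by (simp add: sum.distrib sum_subtractf sum_distrib_left)
  also have "\<dots> \<le> b\<^sup>2 * edge_inner G f f - 2 * b * s + b * s" using Q by simp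
  finally have "b * s \<le> b * (b * edge_inner G f f)" by (simp add: power2_eq_square)
  then show ?thesis using b by (simp add: s_def b_def)
qed

text \<open>\<open>t\<close> and \<open>a\<close> are thresholds for the two eigenvalue counts: at
  least \<open>i\<close> eigenvalues of the metric graph are at most \<open>t\<close>, fewer than
  \<open>i\<close> of the dual graph are at most \<open>a\<close>. Comparing thresholds avoids
  ordered lists of eigenvalues.\<close>

lemma eigenvalue_lower_bound:
  assumes wirt: "\<And>j f g \<phi>. j \<in> {1..k} \<Longrightarrow> edgewise_C1 G f g \<phi> \<Longrightarrow>
      (2 * pi / L j)\<^sup>2 * ((\<Sum>e\<in>A j. integral {0..len G e} (\<lambda>x. f (e, x) * f (e, x))) -
          (\<Sum>e\<in>A j. integral {0..len G e} (\<lambda>x. f (e, x)))\<^sup>2 / L j)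
      \<le> (\<Sum>e\<in>A j. integral {0..len G e} (\<lambda>x. g (e, x) * g (e, x)))"
    and i: "i \<in> {1..k}"
    and c: "0 < c" "\<And>j. j \<in> {1..k} \<Longrightarrow> c \<le> 1 / (L j)\<^sup>2"
    and t: "i \<le> (\<Sum>s\<in>{s. s \<le> t \<and> is_eigenvalue (laplacian G) s}. multiplicity (laplacian G) s)"
    and a: "(\<Sum>s\<in>{s. s \<le> a \<and> is_eigenvalue (normalized_laplacian {1..k} W) s}.
      multiplicity (normalized_laplacian {1..k} W) s) < i"
  shows "2 * pi\<^sup>2 * c * a \<le> t"
proof -
  from dual.low_modes[of a] obtain R where R: "finite R" and
    card_R: "card R \<le> (\<Sum>s\<in>{s. s \<le> a \<and> is_eigenvalue (normalized_laplacian {1..k} W) s}.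
      multiplicity (normalized_laplacian {1..k} W) s)"
    and low: "\<forall>f\<in>dual.fs. f \<noteq> 0 \<longrightarrow> (\<forall>g\<in>R. dual.inner_deg g f = 0) \<longrightarrow>
      a * dual.inner_deg f f < dual.inner_deg (dual.lap f) f"
    by (elim exE conjE)
  note R = R order_le_less_trans[OF card_R a]
  have a2: "a < 2"
  proof (rule low_mode_lt_2[OF R(1)])
    show "card R < k" using R(2) i by simp
  qed (use low in blast)
  \<comment> \<open>By adjointness, orthogonality of the mean vector to a mode \<open>r\<close> is a
    linear condition on the edge integrals of \<open>f\<close>, with coefficients
    \<open>edge_sum r\<close>.\<close>
  obtain f g \<phi> where C1: "edgewise_C1 G f g \<phi>" and pos: "0 < edge_inner G f f"
    and energy: "edge_inner G g g \<le> t * edge_inner G f f"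
    and orth: "\<forall>r\<in>R. (\<Sum>e\<in>edges G. edge_sum r e * integral {0..len G e} (\<lambda>x. f (e, x))) = 0"
    using low_energy_function[OF _ t R, of edge_sum] i by auto
  let ?I = "\<lambda>e. integral {0..len G e} (\<lambda>x. f (e, x))"
  let ?K = "\<lambda>e. integral {0..len G e} (\<lambda>x. f (e, x) * f (e, x))"
  let ?D = "\<lambda>e. integral {0..len G e} (\<lambda>x. g (e, x) * g (e, x))"
  \<comment> \<open>The vector of means over the cycles; the value 0 outside \<open>{1..k}\<close>
    places it in \<open>dual.fs\<close>.\<close>
  define m where "m j = (if j \<in> {1..k} then (\<Sum>e\<in>A j. ?I e) / L j else 0)" for j
  have m: "L j * m j = (\<Sum>e\<in>A j. ?I e)" if "j \<in> {1..k}" for j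
    using L_pos[OF that] that by (simp add: m_def)
  have "dual.inner_deg r m = 0" if r: "r \<in> R" for r
  proof -
    have "dual.inner_deg r m = (\<Sum>j\<in>{1..k}. r j * (L j * m j))" by (simp add: inner_deg_eq mult_ac)
    also have "\<dots> = (\<Sum>j\<in>{1..k}. r j * (\<Sum>e\<in>edges G. of_bool (e \<in> A j) * ?I e))"
      by (intro sum.cong refl) (simp only: m, simp only: sum_member)
    also have "\<dots> = (\<Sum>j\<in>{1..k}. \<Sum>e\<in>edges G. of_bool (e \<in> A j) * r j * ?I e)"
      unfolding sum_distrib_left by (simp only: mult_ac)
    also have "\<dots> = (\<Sum>e\<in>edges G. edge_sum r e * ?I e)"
      unfolding edge_sum_def sum_distrib_right by (rule sum.swap)
    finally show ?thesis using orth r by simp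
  qed
  then have "m \<noteq> 0 \<Longrightarrow> a * dual.inner_deg m m < dual.inner_deg (dual.lap m) m"
    using low[rule_format, of m] by (simp add: m_def)
  from mean_energy_bound[OF C1 a2 this m]
  have s: "dual.inner_deg m m \<le> (2 - a) * edge_inner G f f" .
  have cycle: "4 * pi\<^sup>2 * c * ((\<Sum>e\<in>A j. ?K e) - L j * (m j * m j)) \<le> (\<Sum>e\<in>A j. ?D e)"
    if j: "j \<in> {1..k}" for j
  proof -
    let ?X = "(\<Sum>e\<in>A j. ?K e) - L j * (m j * m j)"
    have "(\<Sum>e\<in>A j. ?I e)\<^sup>2 / L j = L j * (m j * m j)"
      using L_pos[OF j] unfolding m[OF j, symmetric] by (simp add: power2_eq_square)
    then have W: "(2 * pi / L j)\<^sup>2 * ?X \<le> (\<Sum>e\<in>A j. ?D e)" using wirt[OF j C1] by simp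
    show ?thesis
    \<comment> \<open>Passing from \<open>1 / (L j)\<^sup>2\<close> to the smaller \<open>c\<close>
      preserves the inequality only for a nonnegative factor. For a negative factor the left side is
      at most 0 and the right side is nonnegative.\<close>
    proof (cases "0 \<le> ?X")
      case True
      have "4 * pi\<^sup>2 * c \<le> 4 * pi\<^sup>2 * (1 / (L j)\<^sup>2)" using c(2)[OF j] by (intro mult_left_mono) auto
      also have "\<dots> = (2 * pi / L j)\<^sup>2" by (simp add: power_divide power_mult_distrib)
      finally have "4 * pi\<^sup>2 * c * ?X \<le> (2 * pi / L j)\<^sup>2 * ?X" using True by (rule mult_right_mono)
      then show ?thesis using W by (rule order_trans)
    next
      case False
      have "0 \<le> (\<Sum>e\<in>A j. ?D e)"
      proof (intro sum_nonneg integral_nonneg integrable_continuous_real continuous_on_mult)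
        show "continuous_on {0..len G e} (\<lambda>x. g (e, x))" if "e \<in> A j" for e
          using edgewise_C1_continuous(2)[OF C1] cover_edges[OF j] that by blast
        then show "continuous_on {0..len G e} (\<lambda>x. g (e, x))" if "e \<in> A j" for e using that by blast
      qed simp
      moreover have "4 * pi\<^sup>2 * c * ?X \<le> 0" using False c(1) by (intro mult_nonneg_nonpos) auto
      ultimately show ?thesis by linarith
    qed
  qed
  have "(\<Sum>j\<in>{1..k}. 4 * pi\<^sup>2 * c * ((\<Sum>e\<in>A j. ?K e) - L j * (m j * m j))) \<le> (\<Sum>j\<in>{1..k}. \<Sum>e\<in>A j. ?D e)"
    by (intro sum_mono cycle)
  \<comment> \<open>Every edge lies in two cycles, so both the norm and the energy are doubled; the
    factor 2 on the right is what reduces \<open>4 * pi\<^sup>2\<close> to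
    \<open>2 * pi\<^sup>2\<close>.\<close>
  then have "4 * pi\<^sup>2 * c * (2 * edge_inner G f f - dual.inner_deg m m) \<le> 2 * edge_inner G g g"
    unfolding sum_distrib_left[symmetric] sum_subtractf sum_sum_cover inner_deg_eq[symmetric]
    by (simp only: edge_inner_def)
  moreover have "4 * pi\<^sup>2 * c * (a * edge_inner G f f) \<le> 4 * pi\<^sup>2 * c * (2 * edge_inner G f f - dual.inner_deg m m)"
    using s c(1) by (intro mult_left_mono) (auto simp: algebra_simps)
  ultimately have "(2 * pi\<^sup>2 * c * a) * edge_inner G f f \<le> t * edge_inner G f f"
    using energy by (simp add: mult_ac)
  then show ?thesis using pos by simp
qed

end

section \<open>Passage to the ordered eigenvalues\<close>

theorem proposition3p3:
  fixes G :: "('v, 'e) mgraph"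
    and C :: "nat \<Rightarrow> ('e \<times> real) set"
    and k :: nat
  assumes "metric_graph G"
    and "planar G"
    and "cycle_double_cover G k C"
  shows "\<forall>i\<in>{1..k}.
    nth_eigenvalue (laplacian G) i \<ge>
      ereal (2 * pi\<^sup>2) * nth_eigenvalue (normalized_laplacian {1..k} (dual_weight G C)) i *
      ereal (MIN j\<in>{1..k}. 1 / (mg_length G (C j))\<^sup>2)"
proof
  fix i assume i: "i \<in> {1..k}"
  interpret metric_graph G by fact
  have cyc: "\<forall>j\<in>{1..k}. cycle_within G (C j)"
    and ae: "AE z in mg_measure G. card {j \<in> {1..k}. z \<in> C j} = 2"
    using assms(3) by (auto simp: cycle_double_cover_def)
  let ?wirt = "\<lambda>A. \<forall>f g \<phi>. edgewise_C1 G f g \<phi> \<longrightarrow>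
      (2 * pi / (\<Sum>e\<in>A. len G e))\<^sup>2 *
        ((\<Sum>e\<in>A. integral {0..len G e} (\<lambda>x. f (e, x) * f (e, x))) -
          (\<Sum>e\<in>A. integral {0..len G e} (\<lambda>x. f (e, x)))\<^sup>2 / (\<Sum>e\<in>A. len G e))
      \<le> (\<Sum>e\<in>A. integral {0..len G e} (\<lambda>x. g (e, x) * g (e, x)))"
  \<comment> \<open>The edge sets are chosen together with their Wirtinger inequalities, so that one
    choice of \<open>A\<close> provides both.\<close>
  have "\<forall>j\<in>{1..k}. \<exists>A. A \<subseteq> edges G \<and> A \<noteq> {} \<and> C j = edge_points G A \<and> ?wirt A"
  proof
    fix j assume "j \<in> {1..k}"
    then have "cycle_within G (C j)" using cyc by blast
    then show "\<exists>A. A \<subseteq> edges G \<and> A \<noteq> {} \<and> C j = edge_points G A \<and> ?wirt A"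
      by (rule cycle_within_wirtinger) blast
  qed
  then obtain A where A: "\<forall>j\<in>{1..k}. A j \<subseteq> edges G \<and> A j \<noteq> {} \<and> C j = edge_points G (A j) \<and> ?wirt (A j)"
    by (rule bchoice[THEN exE])
  interpret edge_double_cover G k A
  proof
    show "A j \<subseteq> edges G" "A j \<noteq> {}" if "j \<in> {1..k}" for j using A that by blast+
    show "card {j \<in> {1..k}. e \<in> A j} = 2" if e: "e \<in> edges G" for e
    proof (rule AE_mg_measure_edge_const[OF ae e])
      fix x assume "x \<in> {0..len G e}"
      then have "{j \<in> {1..k}. (e, x) \<in> C j} = {j \<in> {1..k}. e \<in> A j}"
        using A by (auto simp: edge_points_def)
      then show "card {j \<in> {1..k}. (e, x) \<in> C j} = 2 \<longleftrightarrow> card {j \<in> {1..k}. e \<in> A j} = 2" by simp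
    qed
  qed
  have len_C: "mg_length G (C j) = L j" if "j \<in> {1..k}" for j
    using A that mg_length_edge_points by simp
  have weights: "normalized_laplacian {1..k} (dual_weight G C) = normalized_laplacian {1..k} W"
  proof -
    have "dual_weight G C v w = W v w" if "v \<in> {1..k}" "w \<in> {1..k}" for v w
      using A that by (simp add: W_def dual_weight_def)
    then have "weighted_degree {1..k} (dual_weight G C) v = weighted_degree {1..k} W v"
      "(\<Sum>w\<in>{1..k}. dual_weight G C v w * (f v - f w)) = (\<Sum>w\<in>{1..k}. W v w * (f v - f w))"
      if "v \<in> {1..k}" for v f
      using that by (auto simp: weighted_degree_def intro!: sum.cong)
    then show ?thesis
      unfolding normalized_laplacian_def by (intro ext conj_cong ball_cong refl) (simp only:)
  qed
  define c where "c = (MIN j\<in>{1..k}. 1 / (mg_length G (C j))\<^sup>2)"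
  \<comment> \<open>The minimum is attained at some cycle, and its positivity follows from the
    positive length of that cycle.\<close>
  have "c \<in> (\<lambda>j. 1 / (mg_length G (C j))\<^sup>2) ` {1..k}"
    unfolding c_def using i by (intro Min_in) auto
  then obtain j where "j \<in> {1..k}" "c = 1 / (mg_length G (C j))\<^sup>2" by blast
  then have c0: "0 < c" using L_pos[of j] by (simp add: len_C)
  have c1: "c \<le> 1 / (L j)\<^sup>2" if "j \<in> {1..k}" for j
    unfolding c_def len_C[OF that, symmetric] using that by (intro Min_le) auto
  let ?\<alpha> = "nth_eigenvalue (normalized_laplacian {1..k} W) i"
  \<comment> \<open>The eigenvalue of the metric graph is an infimum over such \<open>t\<close>, so
    it suffices to bound each of them.\<close>
  have "ereal (2 * pi\<^sup>2) * ?\<alpha> * ereal c \<le> ereal t"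
    if t: "i \<le> (\<Sum>s\<in>{s. s \<le> t \<and> is_eigenvalue (laplacian G) s}. multiplicity (laplacian G) s)" for t
  proof (rule ccontr)
    assume "\<not> ?thesis"
    \<comment> \<open>The case distinction includes infinite \<open>?\<alpha>\<close>. If the bound
      fails, a real \<open>a\<close> fits strictly below \<open>?\<alpha>\<close>; as
      \<open>?\<alpha>\<close> is an infimum, fewer than \<open>i\<close> eigenvalues are at most
      \<open>a\<close>.\<close>
    then have "ereal (t / (2 * pi\<^sup>2 * c)) < ?\<alpha>"
      using c0 by (cases ?\<alpha>) (auto simp: field_simps)
    then obtain a where a: "ereal (t / (2 * pi\<^sup>2 * c)) < ereal a" "ereal a < ?\<alpha>"
      using ereal_dense2 by blast
    have "(\<Sum>s\<in>{s. s \<le> a \<and> is_eigenvalue (normalized_laplacian {1..k} W) s}.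
        multiplicity (normalized_laplacian {1..k} W) s) < i"
    proof (rule ccontr)
      assume "\<not> ?thesis"
      then have "?\<alpha> \<le> ereal a" unfolding nth_eigenvalue_def by (intro Inf_lower) auto
      then show False using a(2) by simp
    qed
    then have "2 * pi\<^sup>2 * c * a \<le> t"
      by (intro eigenvalue_lower_bound[OF _ i c0 c1 t]) (use A in blast)
    then show False using a(1) c0 by (simp add: field_simps)
  qed
  then show "ereal (2 * pi\<^sup>2) * nth_eigenvalue (normalized_laplacian {1..k} (dual_weight G C)) i *
      ereal (MIN j\<in>{1..k}. 1 / (mg_length G (C j))\<^sup>2) \<le> nth_eigenvalue (laplacian G) i"
    unfolding weights c_def[symmetric] nth_eigenvalue_def[of "laplacian G"] by (intro Inf_greatest) auto
qed

end
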